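(* Let $p\in[1,\infty)$. For a prior $\Pi=\Pi_n$, suppose that the Kullback--Leibler condition $$\liminf_{n\to\infty}\Pi_n\big(\{q\in\mathcal F: K(p_0,q)<\epsilon\}\big)>0\quad\text{for every }\epsilon>0$$ holds. Then the consistency of the $p$-th moment, that is, $$\Pi_n\big(|M_p(P)-M_p(P_0)|>\epsilon\mid X_1,\ldots,X_n\big)\to 0\quad\text{in probability for every }\epsilon>0,$$ is equivalent to $$\Pi_n\big(W_p(P,P_0)\ge\epsilon\mid X_1,\ldots,X_n\big)\to 0\quad\text{in probability for every }\epsilon>0.$$
   Context: Setting: $X_1,\ldots,X_n$ are i.i.d. real random variables from a true distribution $P_0$ on $\mathbb R$ possessing a density $p_0$. $\mathcal F$ is a collection of probability densities on $\mathbb R$ equipped with the weak topology, and $\Pi=\Pi_n$ is a prior distribution on $\mathcal F$, which is allowed to depend on the sample size $n$. For a measurable $A\subset\mathcal F$ the posterior probability is $$\Pi_n(A\mid X_1,\ldots,X_n)=\frac{\int_A\prod_{i=1}^n q(X_i)/p_0(X_i)\,d\Pi_n(q)}{\int_{\mathcal F}\prod_{i=1}^n q(X_i)/p_0(X_i)\,d\Pi_n(q)}.$$ A density is identified with its probability measure, and $P$ inside $\Pi_n(\cdot\mid X_1,\ldots,X_n)$ denotes the probability measure whose density is distributed according to the posterior. Convergence in probability is with respect to the true distribution $P_0$ of the data, as $n\to\infty$. Notation: $M_p(P)=\int|x|^p\,dP(x)$; $K(p_0,q)=\int\log[p_0(x)/q(x)]\,dP_0(x)$ is the Kullback--Leibler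 divergence; $W_p(P,Q)=\inf_{\pi}\big(\int_{\mathbb R^2}|x-y|^p\,d\pi(x,y)\big)^{1/p}$ is the Wasserstein metric of order $p$, the infimum being over all couplings $\pi$ of $P$ and $Q$ (Borel probability measures on $\mathbb R^2$ with marginals $P$ and $Q$). *)

theory Defs
  imports "HOL-Probability.Probability"
begin

definition prob_density :: "(real \<Rightarrow> real) \<Rightarrow> bool" where
  "prob_density q \<longleftrightarrow>
     q \<in> borel_measurable borel \<and> (\<forall>x. 0 \<le> q x) \<and> (\<integral>\<^sup>+x. ennreal (q x) \<partial>lborel) = 1"

definition density_measure :: "(real \<Rightarrow> real) \<Rightarrow> real measure" where
  "density_measure q = density lborel (\<lambda>x. ennreal (q x))"

text \<open>The weak topology on a set of densities: the coarsest topology for which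
  \<open>q \<mapsto> \<integral>f dQ\<close> is continuous for every bounded continuous \<open>f\<close>, where \<open>Q\<close> is the
  probability measure with density \<open>q\<close>.\<close>

definition weak_topology :: "(real \<Rightarrow> real) set \<Rightarrow> (real \<Rightarrow> real) topology" where
  "weak_topology F = topology_generated_by
     {{q \<in> F. (\<integral>x. f x \<partial>density_measure q) \<in> U} | (f :: real \<Rightarrow> real) (U :: real set).
        continuous_on UNIV f \<and> bounded (range f) \<and> open U}"

definition weak_borel :: "(real \<Rightarrow> real) set \<Rightarrow> (real \<Rightarrow> real) measure" where
  "weak_borel F = sigma F {U. openin (weak_topology F) U}"

definition moment :: "real \<Rightarrow> real measure \<Rightarrow> ennreal" where
  "moment p P = (\<integral>\<^sup>+x. ennreal (\<bar>x\<bar> powr p) \<partial>P)"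

definition log_ratio :: "real \<Rightarrow> real \<Rightarrow> ereal" where
  "log_ratio a b = (if b = 0 then \<infinity> else ereal (ln (a / b)))"

text \<open>The library constant \<open>KL_divergence\<close> is a Bochner integral and hence \<open>0\<close> when the
  log-ratio is not integrable. The divergence is therefore the extended Lebesgue integral,
  positive part minus negative part (\<open>e2ennreal\<close> sends negative arguments to \<open>0\<close>). The negative
  part always has a finite integral for probability densities. The value of \<open>log_ratio a b\<close>
  at \<open>a = 0\<close> is irrelevant, because \<open>p0 > 0\<close> almost everywhere under \<open>P0\<close>.\<close>

definition KL :: "(real \<Rightarrow> real) \<Rightarrow> (real \<Rightarrow> real) \<Rightarrow> ereal" where
  "KL p0 q =
     enn2ereal (\<integral>\<^sup>+x. e2ennreal (log_ratio (p0 x) (q x)) \<partial>density_measure p0)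
   - enn2ereal (\<integral>\<^sup>+x. e2ennreal (- log_ratio (p0 x) (q x)) \<partial>density_measure p0)"

definition couplings :: "real measure \<Rightarrow> real measure \<Rightarrow> (real \<times> real) measure set" where
  "couplings P Q = {\<pi>. prob_space \<pi> \<and> sets \<pi> = sets borel \<and>
     distr \<pi> borel fst = P \<and> distr \<pi> borel snd = Q}"

definition ennroot :: "real \<Rightarrow> ennreal \<Rightarrow> ennreal" where
  "ennroot p a = (if a = \<infinity> then \<infinity> else ennreal (enn2real a powr (1 / p)))"

definition wasserstein :: "real \<Rightarrow> real measure \<Rightarrow> real measure \<Rightarrow> ennreal" where
  "wasserstein p P Q =
     (INF \<pi>\<in>couplings P Q. ennroot p (\<integral>\<^sup>+z. ennreal (\<bar>fst z - snd z\<bar> powr p) \<partial>\<pi>))"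

text \<open>The posterior mass of \<open>A\<close> under \<open>prior\<close> given the observations \<open>x 0, \<dots>, x (n - 1)\<close>.\<close>

definition posterior ::
  "(real \<Rightarrow> real) \<Rightarrow> (real \<Rightarrow> real) measure \<Rightarrow> nat \<Rightarrow> (nat \<Rightarrow> real) \<Rightarrow> (real \<Rightarrow> real) set \<Rightarrow> real"
where
  "posterior p0 prior n x A = enn2real (
     (\<integral>\<^sup>+q\<in>A. ennreal (\<Prod>i<n. q (x i) / p0 (x i)) \<partial>prior)
     / (\<integral>\<^sup>+q. ennreal (\<Prod>i<n. q (x i) / p0 (x i)) \<partial>prior))"

definition tendsto_in_prob :: "'a measure \<Rightarrow> (nat \<Rightarrow> 'a \<Rightarrow> real) \<Rightarrow> real \<Rightarrow> bool" where
  "tendsto_in_prob M Y c \<longleftrightarrow>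
     (\<forall>\<delta>>0. (\<lambda>n. measure M {\<omega> \<in> space M. dist (Y n \<omega>) c > \<delta>}) \<longlonglongrightarrow> 0)"

text \<open>Joint measurability of \<open>(q, x) \<mapsto> q x\<close> makes the integrals in the posterior well defined
  and the posterior a random variable. Every set of absolutely continuous probability measures
  has densities with this property, e.g. the symmetric upper derivatives where these are finite
  (and \<open>0\<close> elsewhere).\<close>

definition density_model :: "(real \<Rightarrow> real) set \<Rightarrow> bool" where
  "density_model F \<longleftrightarrow> (\<forall>q\<in>F. prob_density q) \<and>
     (\<lambda>(q, x). q x) \<in> borel_measurable (weak_borel F \<Otimes>\<^sub>M (borel :: real measure))"

definition prior_on :: "(real \<Rightarrow> real) set \<Rightarrow> (real \<Rightarrow> real) measure \<Rightarrow> bool" where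
  "prior_on F prior \<longleftrightarrow> prob_space prior \<and> sets prior = sets (weak_borel F)"

end

theory Submission
  imports Defs
begin

text \<open>Both conditions only depend on the posterior mass of neighbourhoods of the true law. On the
  line, convergence of the distribution functions at the rationals together with convergence of
  the \<open>p\<close>-th moment implies \<open>W\<^sub>p\<close>-convergence, because the monotone rearrangements converge
  almost everywhere and Fatou's lemma applied to
  \<open>2\<^sup>p (\<bar>x\<bar>\<^sup>p + \<bar>y\<bar>\<^sup>p) - \<bar>x - y\<bar>\<^sup>p\<close> bounds the transport cost. Hence
  \<open>{W\<^sub>p \<ge> \<epsilon>}\<close> is covered by a moment deviation and finitely many deviations of the
  distribution function. The latter have vanishing posterior mass by Schwartz's argument: a
  Chernoff bound controls the numerator, and the Kullback--Leibler condition bounds the denominator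
  from below by \<open>exp (- \<beta> n)\<close>. Since the prior may change with \<open>n\<close>, there is no law
  of large numbers for the denominator; instead Markov's inequality is used on Kullback--Leibler
  balls of arbitrarily small radius. Conversely, \<open>W\<^sub>p\<close> controls the moment.\<close>

section \<open>Wasserstein neighbourhoods on the line\<close>

text \<open>Two obstacles shape the details. Markov's inequality needs a nonnegative integrand,
  while the log-likelihood ratio is signed. It is replaced by its positive part, whose mean over a
  Kullback--Leibler ball of radius \<open>\<delta>\<^sup>2 / 2\<close> is at most
  \<open>\<delta> + \<delta>\<^sup>2 / 2\<close>: of the order of the square root of the radius, but
  still small. Against a budget proportional to \<open>n\<close>, the probability of failure is then
  a constant multiple of \<open>\<delta>\<close>, uniformly in \<open>n\<close>. The other obstacle
  is measurability. The event of a large posterior mass is only ever compared with a larger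
  measurable event, so the set of densities at distance at least \<open>\<epsilon>\<close> has to be
  measurable. This requires Wasserstein balls around the true law to be sequentially open at every
  law of finite moment, not just at their centre, which is why the transport argument carries a
  third law. Densities exclude atoms, and a law without atoms can be carried onto any other law by a
  map, so no randomised transport is needed.\<close>

lemma powr_abs_diff_le:
  fixes a b p :: real
  assumes "0 \<le> p"
  shows "\<bar>a - b\<bar> powr p \<le> 2 powr p * (\<bar>a\<bar> powr p + \<bar>b\<bar> powr p)"
proof -
  have "\<bar>a - b\<bar> powr p \<le> (2 * max \<bar>a\<bar> \<bar>b\<bar>) powr p"
    using assms by (intro powr_mono2) auto
  also have "\<dots> = 2 powr p * max \<bar>a\<bar> \<bar>b\<bar> powr p"
    by (simp add: powr_mult)
  also have "\<dots> \<le> 2 powr p * (\<bar>a\<bar> powr p + \<bar>b\<bar> powr p)"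
    by (intro mult_left_mono) (auto simp: max_def)
  finally show ?thesis .
qed

text \<open>The integrals of \<open>\<bar>f n x - g x\<bar> powr p\<close> and of its nonnegative
  complement \<open>k\<close> have a convergent sum with finite limit. Fatou's lemma keeps the
  complement from falling below its limit, so the first integral cannot exceed its own by much. The
  function \<open>g\<close> is general because it will be the second coordinate of a
  coupling.\<close>

lemma nn_integral_powr_diff_eventually_less:
  fixes f :: "nat \<Rightarrow> 'b \<Rightarrow> real" and \<phi> g :: "'b \<Rightarrow> real"
  assumes [measurable]: "\<And>n. f n \<in> borel_measurable N" "\<phi> \<in> borel_measurable N"
      "g \<in> borel_measurable N"
    and p: "0 < p"
    and lim: "AE x in N. (\<lambda>n. f n x) \<longlonglongrightarrow> \<phi> x"
    and mom: "(\<lambda>n. \<integral>\<^sup>+x. ennreal (\<bar>f n x\<bar> powr p) \<partial>N) \<longlonglongrightarrow> (\<integral>\<^sup>+x. ennreal (\<bar>\<phi> x\<bar> powr p) \<partial>N)"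
    and fin: "(\<integral>\<^sup>+x. ennreal (\<bar>\<phi> x\<bar> powr p) \<partial>N) < \<infinity>"
    and fing: "(\<integral>\<^sup>+x. ennreal (\<bar>g x\<bar> powr p) \<partial>N) < \<infinity>"
    and less: "(\<integral>\<^sup>+x. ennreal (\<bar>\<phi> x - g x\<bar> powr p) \<partial>N) < c"
  shows "\<forall>\<^sub>F n in sequentially. (\<integral>\<^sup>+x. ennreal (\<bar>f n x - g x\<bar> powr p) \<partial>N) < c"
proof -
  define C where "C = (2::real) powr p"
  have C: "C \<ge> 0" by (simp add: C_def)
  define k where "k u x = C * (\<bar>u\<bar> powr p + \<bar>g x\<bar> powr p) - \<bar>u - g x\<bar> powr p" for u x
  have k0: "k u x \<ge> 0" for u x
    unfolding k_def C_def using powr_abs_diff_le[of p u "g x"] p by simp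
  define a where "a n = (\<integral>\<^sup>+x. ennreal (\<bar>f n x - g x\<bar> powr p) \<partial>N)" for n
  define b where "b n = (\<integral>\<^sup>+x. ennreal (k (f n x) x) \<partial>N)" for n
  define a0 where "a0 = (\<integral>\<^sup>+x. ennreal (\<bar>\<phi> x - g x\<bar> powr p) \<partial>N)"
  define b0 where "b0 = (\<integral>\<^sup>+x. ennreal (k (\<phi> x) x) \<partial>N)"
  have split: "(\<integral>\<^sup>+x. ennreal (\<bar>h x - g x\<bar> powr p) \<partial>N) + (\<integral>\<^sup>+x. ennreal (k (h x) x) \<partial>N)
      = ennreal C * ((\<integral>\<^sup>+x. ennreal (\<bar>h x\<bar> powr p) \<partial>N) + (\<integral>\<^sup>+x. ennreal (\<bar>g x\<bar> powr p) \<partial>N))"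
    if [measurable]: "h \<in> borel_measurable N" for h
  proof -
    have [measurable]: "(\<lambda>x. k (h x) x) \<in> borel_measurable N" unfolding k_def by measurable
    have "(\<integral>\<^sup>+x. ennreal (\<bar>h x - g x\<bar> powr p) \<partial>N) + (\<integral>\<^sup>+x. ennreal (k (h x) x) \<partial>N)
       = (\<integral>\<^sup>+x. ennreal (\<bar>h x - g x\<bar> powr p) + ennreal (k (h x) x) \<partial>N)"
      by (rule nn_integral_add[symmetric]) auto
    also have "\<dots> = (\<integral>\<^sup>+x. ennreal C * (ennreal (\<bar>h x\<bar> powr p) + ennreal (\<bar>g x\<bar> powr p)) \<partial>N)"
    proof (rule nn_integral_cong)
      fix x
      have "ennreal (\<bar>h x - g x\<bar> powr p) + ennreal (k (h x) x)
         = ennreal (\<bar>h x - g x\<bar> powr p + k (h x) x)"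
        using k0 by (simp add: ennreal_plus)
      also have "\<dots> = ennreal (C * (\<bar>h x\<bar> powr p + \<bar>g x\<bar> powr p))"
        by (simp add: k_def)
      also have "\<dots> = ennreal C * (ennreal (\<bar>h x\<bar> powr p) + ennreal (\<bar>g x\<bar> powr p))"
        using C by (simp add: ennreal_mult' ennreal_plus)
      finally show "ennreal (\<bar>h x - g x\<bar> powr p) + ennreal (k (h x) x)
         = ennreal C * (ennreal (\<bar>h x\<bar> powr p) + ennreal (\<bar>g x\<bar> powr p))" .
    qed
    finally show ?thesis by (simp add: nn_integral_cmult nn_integral_add)
  qed
  have sum_lim: "(\<lambda>n. a n + b n) \<longlonglongrightarrow> a0 + b0"
    unfolding a_def b_def a0_def b0_def
    by (subst split, simp)+ (intro ennreal_tendsto_cmult tendsto_add mom tendsto_const, simp)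
  have fin0: "a0 + b0 < \<infinity>"
    unfolding a0_def b0_def using fin fing
    by (subst split) (auto simp: ennreal_mult_less_top)
  have [measurable]: "(\<lambda>x. k (\<phi> x) x) \<in> borel_measurable N" 
    "(\<lambda>x. k (f n x) x) \<in> borel_measurable N" for n unfolding k_def by measurable
  have b0_le: "b0 \<le> liminf b"
  proof -
    have "b0 = (\<integral>\<^sup>+x. liminf (\<lambda>n. ennreal (k (f n x) x)) \<partial>N)"
      unfolding b0_def
    proof (rule nn_integral_cong_AE)
      show "AE x in N. ennreal (k (\<phi> x) x) = liminf (\<lambda>n. ennreal (k (f n x) x))"
        using lim
      proof eventually_elim
        case (elim x)
        have "(\<lambda>n. \<bar>f n x\<bar> powr p) \<longlonglongrightarrow> \<bar>\<phi> x\<bar> powr p"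
          "(\<lambda>n. \<bar>f n x - g x\<bar> powr p) \<longlonglongrightarrow> \<bar>\<phi> x - g x\<bar> powr p"
          using p by (auto intro!: tendsto_powr' tendsto_rabs tendsto_diff elim)
        then have "(\<lambda>n. k (f n x) x) \<longlonglongrightarrow> k (\<phi> x) x"
          unfolding k_def
            by (intro tendsto_diff tendsto_mult tendsto_add tendsto_const)
        then have "(\<lambda>n. ennreal (k (f n x) x)) \<longlonglongrightarrow> ennreal (k (\<phi> x) x)"
          by (rule tendsto_ennrealI)
        then show ?case by (intro lim_imp_Liminf[symmetric]) auto
      qed
    qed
    also have "\<dots> \<le> liminf b"
      unfolding b_def by (rule nn_integral_liminf) simp
    finally show ?thesis .
  qed
  \<comment> \<open>Half of the slack \<open>2 * e\<close> pays for the convergence of the sum, the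
    other half for Fatou's lemma.\<close>
  have "a0 < c" using less by (simp add: a0_def)
  then obtain e :: real where e: "0 < e" "a0 + ennreal (2 * e) \<le> c"
  proof -
    obtain a' where a': "a0 = ennreal a'" "0 \<le> a'"
      using \<open>a0 < c\<close> by (cases a0) auto
    show thesis
    proof (cases c)
      case (real c')
      then have "a' < c'" using \<open>a0 < c\<close> a' by (auto simp: ennreal_less_iff)
      then show thesis
        using a' real by (intro that[of "(c' - a') / 2"]) (auto simp: ennreal_plus[symmetric] field_simps simp del: ennreal_plus)
    next
      case top
      then show thesis by (intro that[of 1]) auto
    qed
  qed
  have ev1: "\<forall>\<^sub>F n in sequentially. a n + b n < a0 + b0 + ennreal e"
  proof (rule order_tendstoD(2)[OF sum_lim])
    show "a0 + b0 < a0 + b0 + ennreal e"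
      using fin0 e(1) by (cases "a0 + b0") (auto simp: ennreal_plus[symmetric] ennreal_less_iff simp del: ennreal_plus)
  qed
  have ev2: "\<forall>\<^sub>F n in sequentially. b0 \<le> b n + ennreal e"
  proof (cases "b0 = 0")
    case False
    have "b0 - ennreal e < b0"
      using False fin0 e(1) by (intro ennreal_between) (auto simp: less_top[symmetric] zero_less_iff_neq_zero)
    then have "\<forall>\<^sub>F n in sequentially. b0 - ennreal e < b n"
      using b0_le less_LiminfD by (metis order_less_le_trans)
    then show ?thesis
      by eventually_elim (metis add.commute ennreal_minus_le_iff less_imp_le ennreal_neq_top)
  qed simp
  show ?thesis using ev1 ev2
  proof eventually_elim
    case (elim n)
    \<comment> \<open>Cancelling \<open>b n\<close> at the end is legitimate only because it is
      finite.\<close>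
    have bfin: "b n < \<infinity>" using elim(1) fin0
      by (metis add_top_right_ennreal infinity_ennreal_def less_top top.extremum_strict)
    have "a n + b n < a0 + b0 + ennreal e" by fact
    also have "\<dots> \<le> a0 + (b n + ennreal e) + ennreal e"
      by (intro add_mono elim order_refl)
    also have "\<dots> = (a0 + ennreal (2 * e)) + b n"
      using e(1) by (simp add: ac_simps ennreal_plus[symmetric] mult_2 del: ennreal_plus)
    also have "\<dots> \<le> c + b n" by (intro add_mono e order_refl)
    finally have "a n + b n < c + b n" .
    then show ?case using bfin unfolding a_def
      by (metis add.commute add_left_mono leD leI)
  qed
qed

section \<open>Transport cost and couplings\<close>

lemma ennroot_less_iff:
  assumes "0 < p" "0 < \<epsilon>"
  shows "ennroot p a < ennreal \<epsilon> \<longleftrightarrow> a < ennreal (\<epsilon> powr p)"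
proof (cases a)
  case (real r)
  have "r powr (1 / p) < \<epsilon> \<longleftrightarrow> (r powr (1 / p)) powr p < \<epsilon> powr p"
  proof
    assume "(r powr (1 / p)) powr p < \<epsilon> powr p"
    then have "\<not> \<epsilon> powr p \<le> (r powr (1 / p)) powr p" by simp
    then have "\<not> \<epsilon> \<le> r powr (1 / p)"
      using assms powr_mono2[of p \<epsilon> "r powr (1 / p)"] by auto
    then show "r powr (1 / p) < \<epsilon>" by simp
  qed (use assms in \<open>auto intro: powr_less_mono2\<close>)
  also have "(r powr (1 / p)) powr p = r"
    using assms real by (simp add: powr_powr)
  finally show ?thesis
    using real assms by (simp add: ennroot_def ennreal_less_iff)
qed (simp add: ennroot_def)

text \<open>A strict bound on an infimum is witnessed by a single coupling. Working with strict
  balls throughout avoids the existence of optimal couplings.\<close>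

lemma wasserstein_less_iff:
  assumes "0 < p" "0 < \<epsilon>"
  shows "wasserstein p P Q < ennreal \<epsilon> \<longleftrightarrow>
    (\<exists>\<pi>\<in>couplings P Q. (\<integral>\<^sup>+z. ennreal (\<bar>fst z - snd z\<bar> powr p) \<partial>\<pi>) < ennreal (\<epsilon> powr p))"
  unfolding wasserstein_def INF_less_iff ennroot_less_iff[OF assms] ..

lemma borel_pair_measurable:
  assumes "sets \<pi> = sets (borel :: (real \<times> real) measure)"
  shows "fst \<in> borel_measurable \<pi>" "snd \<in> borel_measurable \<pi>"
  using measurable_fst[of "borel :: real measure" "borel :: real measure"]
    measurable_snd[of "borel :: real measure" "borel :: real measure"]
  by (simp_all add: measurable_cong_sets[OF assms refl] borel_prod)

lemma coupling_nn_integral_fst: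
  assumes "\<pi> \<in> couplings P Q" "f \<in> borel_measurable borel"
  shows "(\<integral>\<^sup>+z. f (fst z) \<partial>\<pi>) = (\<integral>\<^sup>+x. f x \<partial>P)"
  using assms borel_pair_measurable[of \<pi>]
  by (auto simp: couplings_def nn_integral_distr)

lemma coupling_nn_integral_snd:
  assumes "\<pi> \<in> couplings P Q" "f \<in> borel_measurable borel"
  shows "(\<integral>\<^sup>+z. f (snd z) \<partial>\<pi>) = (\<integral>\<^sup>+x. f x \<partial>Q)"
  using assms borel_pair_measurable[of \<pi>]
  by (auto simp: couplings_def nn_integral_distr)

lemma coupling_AE_fst:
  assumes "\<pi> \<in> couplings P Q" "AE x in P. R x"
  shows "AE z in \<pi>. R (fst z)"
  using assms borel_pair_measurable[of \<pi>]
  by (auto simp: couplings_def intro: AE_distrD)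

lemma wasserstein_self:
  assumes P: "prob_space P" "sets P = sets borel" and "0 < p" "0 < \<epsilon>"
  shows "wasserstein p P P < ennreal \<epsilon>"
proof -
  interpret P: prob_space P by fact
  have [measurable_cong]: "sets P = sets borel" by fact
  let ?\<pi> = "distr P borel (\<lambda>x. (x, x))"
  have [measurable]: "(\<lambda>x. (x, x)) \<in> P \<rightarrow>\<^sub>M (borel :: (real \<times> real) measure)"
    unfolding borel_prod[symmetric] by measurable
  note [measurable] = borel_pair_measurable[of "borel :: (real \<times> real) measure", OF refl]
  have "?\<pi> \<in> couplings P P"
    unfolding couplings_def
    by (auto intro!: P.prob_space_distr simp: distr_distr comp_def distr_id2[OF P(2)[symmetric]])
  moreover have "(\<integral>\<^sup>+z. ennreal (\<bar>fst z - snd z\<bar> powr p) \<partial>?\<pi>) = 0"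
    using assms by (simp add: nn_integral_distr)
  ultimately show ?thesis
    unfolding wasserstein_less_iff[OF assms(3,4)] using assms by (intro bexI[of _ ?\<pi>]) auto
qed

section \<open>Quantile transform and monotone rearrangement\<close>

context cdf_distribution
begin

text \<open>Without atoms the distribution function is continuous, so the quantile function
  \<open>I\<close> is an exact right inverse of it on the open unit interval, and
  \<open>cdf M\<close> is uniform under \<open>M\<close>. The uniform law has no atoms either; hence
  every level set of \<open>cdf M\<close>, in particular every flat piece, is null.\<close>

lemma
  assumes "\<And>x. measure M {x} = 0"
  shows distr_cdf_eq_uniform: "distr M borel (cdf M) = distr (restrict_space lborel {0<..<1}) borel (\<lambda>x. x)"
    and AE_cdf_neq: "AE x in M. cdf M x \<noteq> c"
proof -
  let ?\<Omega> = "restrict_space lborel {0<..<1::real}"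
  have cdf_I: "cdf M (I u) = u" if u: "u \<in> {0<..<1}" for u
  proof (rule antisym)
    show "u \<le> cdf M (I u)" using pseudoinverse[of u "I u"] u by auto
    have "isCont (cdf M) (I u)" using assms by (simp add: isCont_cdf)
    then have "(cdf M \<longlongrightarrow> cdf M (I u)) (at_left (I u))"
      by (meson continuous_at filterlim_at_split)
    moreover have "cdf M y \<le> u" if "y < I u" for y
      using pseudoinverse[of u y] u that by auto
    then have "\<forall>\<^sub>F y in at_left (I u). cdf M y \<le> u"
      by (simp add: eventually_at_filter)
    ultimately show "cdf M (I u) \<le> u"
      by (rule tendsto_upperbound) (simp add: trivial_limit_at_left_real)
  qed
  have [measurable]: "I \<in> ?\<Omega> \<rightarrow>\<^sub>M borel"
    using measurable_CI by (simp add: measurable_cong_sets[OF sets_restrict_space_cong[OF sets_lborel] refl])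
  have "distr M borel (cdf M) = distr (distr ?\<Omega> borel I) borel (cdf M)"
    by (simp add: distr_I_eq_M)
  also have "\<dots> = distr ?\<Omega> borel (cdf M \<circ> I)"
    by (rule distr_distr) auto
  also have "\<dots> = distr ?\<Omega> borel (\<lambda>x. x)"
    using cdf_I by (intro distr_cong) (auto simp: space_restrict_space)
  finally show *: "distr M borel (cdf M) = distr ?\<Omega> borel (\<lambda>x. x)" .
  have idm: "(\<lambda>x. x) \<in> ?\<Omega> \<rightarrow>\<^sub>M borel"
    by (intro measurable_restrict_space1) simp
  have "AE x in lborel. x \<noteq> c" by (rule AE_lborel_singleton)
  then have "AE x in ?\<Omega>. x \<noteq> c" by (subst AE_restrict_space_iff) auto
  then have "AE x in distr ?\<Omega> borel (\<lambda>x. x). x \<noteq> c"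
    using idm by (subst AE_distr_iff) auto
  then show "AE x in M. cdf M x \<noteq> c"
    unfolding *[symmetric] by (subst (asm) AE_distr_iff) auto
qed

end

text \<open>The map \<open>T n\<close> is the monotone rearrangement of \<open>Q\<close> into \<open>Qn n\<close>; pushing the first
  coordinate of a coupling forward along it replaces \<open>Q\<close> by \<open>Qn n\<close> without a gluing lemma.\<close>

lemma transport_maps:
  fixes Qn :: "nat \<Rightarrow> real measure" and Q :: "real measure"
  assumes Qn: "\<And>n. real_distribution (Qn n)" and Q: "real_distribution Q"
    and atomless: "\<And>x. measure Q {x} = 0"
    and cdf_lim: "\<And>r. r \<in> \<rat> \<Longrightarrow> (\<lambda>n. cdf (Qn n) r) \<longlonglongrightarrow> cdf Q r"
  obtains T :: "nat \<Rightarrow> real \<Rightarrow> real" where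
    "\<And>n. T n \<in> borel_measurable borel" "\<And>n. distr Q borel (T n) = Qn n"
    "AE x in Q. (\<lambda>n. T n x) \<longlonglongrightarrow> x"
proof -
  interpret Qn: cdf_distribution "Qn n" for n
    unfolding cdf_distribution_def by (rule Qn)
  interpret Q: cdf_distribution Q
    unfolding cdf_distribution_def by (rule Q)
  let ?\<Omega> = "restrict_space lborel {0<..<1::real}"
  \<comment> \<open>The default 0 makes \<open>J n\<close> Borel on the whole line. It concerns a
    null set only, since \<open>cdf Q\<close> is uniform on the open unit interval under
    \<open>Q\<close>.\<close>
  define J where "J n u = (if u \<in> {0<..<1} then Qn.I n u else 0)" for n u
  have [measurable]: "J n \<in> borel_measurable borel" for n
    using Qn.measurable_CI[of n] unfolding J_def
    by (subst (asm) measurable_restrict_space_iff[where c = "0::real"]) auto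
  define T where "T n = J n \<circ> cdf Q" for n
  have T_meas: "T n \<in> borel_measurable borel" for n
    unfolding T_def by (rule measurable_comp[OF Q.measurable_C]) simp
  have idm: "(\<lambda>x. x) \<in> ?\<Omega> \<rightarrow>\<^sub>M borel"
    by (intro measurable_restrict_space1) simp
  have T_distr: "distr Q borel (T n) = Qn n" for n
  proof -
    have "distr Q borel (T n) = distr (distr Q borel (cdf Q)) borel (J n)"
      unfolding T_def by (rule distr_distr[symmetric]) auto
    also have "\<dots> = distr (distr ?\<Omega> borel (\<lambda>x. x)) borel (J n)"
      by (simp add: Q.distr_cdf_eq_uniform[OF atomless])
    also have "\<dots> = distr ?\<Omega> borel (J n \<circ> (\<lambda>x. x))"
      by (intro distr_distr idm) simp
    also have "\<dots> = distr ?\<Omega> borel (Qn.I n)"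
      by (intro distr_cong) (auto simp: J_def space_restrict_space)
    also have "\<dots> = Qn n" by (rule Qn.distr_I_eq_M)
    finally show ?thesis .
  qed
  \<comment> \<open>Removing countably many null level sets makes the monotonicity of
    \<open>cdf Q\<close> strict between \<open>x\<close> and every rational. Strictness also forces
    \<open>cdf Q x\<close> into the open unit interval, where the quantile functions are
    defined.\<close>
  have "AE x in Q. \<forall>r\<in>\<rat>. cdf Q x \<noteq> cdf Q r"
    using Q.AE_cdf_neq[OF atomless] by (intro AE_ball_countable[THEN iffD2]) (auto simp: countable_rat)
  then have "AE x in Q. (\<lambda>n. T n x) \<longlonglongrightarrow> x"
  proof eventually_elim
    case (elim x)
    have below: "cdf Q r < cdf Q x" if "r \<in> \<rat>" "r < x" for r
      using elim that Q.cdf_nondecreasing[of r x] by (metis less_imp_le order_le_less)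
    have above: "cdf Q x < cdf Q r" if "r \<in> \<rat>" "x < r" for r
      using elim that Q.cdf_nondecreasing[of x r] by (metis less_imp_le order_le_less)
    obtain r1 r2 where "r1 \<in> \<rat>" "r1 < x" "r2 \<in> \<rat>" "x < r2"
      using Rats_dense_in_real[of "x - 1" x] Rats_dense_in_real[of x "x + 1"] by auto
    then have in01: "cdf Q x \<in> {0<..<1}"
      using below[of r1] above[of r2] Q.cdf_nonneg[of r1] Q.cdf_bounded_prob[of r2] by auto
    then have T_eq: "T n x = Qn.I n (cdf Q x)" for n by (simp add: T_def J_def)
    show ?case
    proof (rule order_tendstoI)
      fix y assume "y < x"
      \<comment> \<open>A strict inequality at one rational survives the passage from
        \<open>Q\<close> to \<open>Qn n\<close>; the Galois connection between distribution and
        quantile function turns it into a bound for \<open>T n x\<close>.\<close>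
      then obtain r where r: "r \<in> \<rat>" "y < r" "r < x" using Rats_dense_in_real by blast
      have "\<forall>\<^sub>F n in sequentially. cdf (Qn n) r < cdf Q x"
        using order_tendstoD(2)[OF cdf_lim[OF r(1)] below[OF r(1,3)]] .
      then show "\<forall>\<^sub>F n in sequentially. y < T n x"
      proof eventually_elim
        case (elim n)
        then show ?case
          using Qn.pseudoinverse[of "cdf Q x" n r] in01 r by (auto simp: T_eq)
      qed
    next
      fix y assume "x < y"
      then obtain r where r: "r \<in> \<rat>" "x < r" "r < y" using Rats_dense_in_real by blast
      have "\<forall>\<^sub>F n in sequentially. cdf Q x < cdf (Qn n) r"
        using order_tendstoD(1)[OF cdf_lim[OF r(1)] above[OF r(1,2)]] .
      then show "\<forall>\<^sub>F n in sequentially. T n x < y"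
      proof eventually_elim
        case (elim n)
        then show ?case
          using Qn.pseudoinverse[of "cdf Q x" n r] in01 r by (auto simp: T_eq)
      qed
    qed
  qed
  with T_meas T_distr show thesis by (rule that)
qed

text \<open>One cheap coupling of \<open>Q\<close> and \<open>P\<close> is fixed and only its first
  coordinate is moved along \<open>T n\<close>. All costs are thus integrals over the same space,
  where almost sure convergence and convergence of moments control them. With \<open>Q = P\<close>
  this yields neighbourhoods of the true law, with general \<open>Q\<close> the openness used for
  measurability.\<close>

lemma wasserstein_eventually_less:
  fixes Qn :: "nat \<Rightarrow> real measure" and P Q :: "real measure"
  assumes Qn: "\<And>n. real_distribution (Qn n)" and Q: "real_distribution Q"
    and atomless: "\<And>x. measure Q {x} = 0"
    and cdf_lim: "\<And>r. r \<in> \<rat> \<Longrightarrow> (\<lambda>n. cdf (Qn n) r) \<longlonglongrightarrow> cdf Q r"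
    and mom_lim: "(\<lambda>n. moment p (Qn n)) \<longlonglongrightarrow> moment p Q"
    and fin: "moment p Q < \<infinity>" "moment p P < \<infinity>"
    and p: "0 < p" and \<epsilon>: "0 < \<epsilon>" and less: "wasserstein p Q P < ennreal \<epsilon>"
  shows "\<forall>\<^sub>F n in sequentially. wasserstein p (Qn n) P < ennreal \<epsilon>"
proof -
  obtain T where T[measurable]: "\<And>n. T n \<in> borel_measurable borel"
    and T_distr: "\<And>n. distr Q borel (T n) = Qn n"
    and T_lim: "AE x in Q. (\<lambda>n. T n x) \<longlonglongrightarrow> x"
    using transport_maps[OF Qn Q atomless cdf_lim] by blast
  interpret Q: real_distribution Q by fact
  obtain \<pi> where \<pi>: "\<pi> \<in> couplings Q P"
    and cost: "(\<integral>\<^sup>+z. ennreal (\<bar>fst z - snd z\<bar> powr p) \<partial>\<pi>) < ennreal (\<epsilon> powr p)"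
    using less unfolding wasserstein_less_iff[OF p \<epsilon>] by blast
  interpret \<pi>: prob_space \<pi> using \<pi> by (simp add: couplings_def)
  have sets_\<pi>: "sets \<pi> = sets borel" using \<pi> by (simp add: couplings_def)
  note [measurable] = borel_pair_measurable[OF sets_\<pi>]
    borel_pair_measurable[of "borel :: (real \<times> real) measure", OF refl]
  have mom_T: "(\<integral>\<^sup>+z. ennreal (\<bar>T n (fst z)\<bar> powr p) \<partial>\<pi>) = moment p (Qn n)" for n
    unfolding moment_def T_distr[symmetric]
    by (subst coupling_nn_integral_fst[OF \<pi>, of "\<lambda>x. ennreal (\<bar>T n x\<bar> powr p)"])
       (simp_all add: nn_integral_distr)
  have mom_Q: "(\<integral>\<^sup>+z. ennreal (\<bar>fst z\<bar> powr p) \<partial>\<pi>) = moment p Q"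
    unfolding moment_def
    by (rule coupling_nn_integral_fst[OF \<pi>, of "\<lambda>x. ennreal (\<bar>x\<bar> powr p)"]) simp
  have mom_P: "(\<integral>\<^sup>+z. ennreal (\<bar>snd z\<bar> powr p) \<partial>\<pi>) = moment p P"
    unfolding moment_def
    by (rule coupling_nn_integral_snd[OF \<pi>, of "\<lambda>x. ennreal (\<bar>x\<bar> powr p)"]) simp
  have "\<forall>\<^sub>F n in sequentially.
      (\<integral>\<^sup>+z. ennreal (\<bar>T n (fst z) - snd z\<bar> powr p) \<partial>\<pi>) < ennreal (\<epsilon> powr p)"
    by (rule nn_integral_powr_diff_eventually_less[where f = "\<lambda>n z. T n (fst z)" and \<phi> = fst])
       (use p mom_lim fin cost coupling_AE_fst[OF \<pi> T_lim] in \<open>simp_all add: mom_T mom_Q mom_P\<close>)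
  then show ?thesis
  proof eventually_elim
    case (elim n)
    let ?\<pi> = "distr \<pi> borel (\<lambda>z. (T n (fst z), snd z))"
    have [measurable]: "(\<lambda>z. (T n (fst z), snd z)) \<in> \<pi> \<rightarrow>\<^sub>M (borel :: (real \<times> real) measure)"
      unfolding borel_prod[symmetric] by measurable
    have "distr \<pi> borel (\<lambda>z. T n (fst z)) = distr (distr \<pi> borel fst) borel (T n)"
      by (subst distr_distr) (auto simp: comp_def)
    also have "\<dots> = Qn n" using \<pi> by (simp add: couplings_def T_distr)
    finally have "?\<pi> \<in> couplings (Qn n) P"
      using \<pi> unfolding couplings_def
      by (auto intro!: \<pi>.prob_space_distr simp: distr_distr comp_def)
    moreover have "(\<integral>\<^sup>+z. ennreal (\<bar>fst z - snd z\<bar> powr p) \<partial>?\<pi>) < ennreal (\<epsilon> powr p)"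
      using elim by (simp add: nn_integral_distr)
    ultimately show ?case unfolding wasserstein_less_iff[OF p \<epsilon>] by blast
  qed
qed

section \<open>Moments against transport cost\<close>

text \<open>For moments to be close, the coefficient of \<open>\<bar>y\<bar> powr p\<close> must be
  close to 1; a factor such as \<open>2 powr p\<close> would only give boundedness. The price is a
  large \<open>K\<close>.\<close>

lemma powr_abs_le_perturb:
  fixes p \<eta> :: real
  assumes "0 < p" "0 < \<eta>"
  obtains K where "0 \<le> K"
    "\<And>x y. \<bar>x\<bar> powr p \<le> (1 + \<eta>) * \<bar>y\<bar> powr p + K * \<bar>x - y\<bar> powr p"
proof -
  \<comment> \<open>This \<open>t\<close> solves \<open>(1 + t) powr p = 1 + \<eta>\<close>. If the
    relative perturbation is at most \<open>t\<close>, the first term suffices; otherwise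
    \<open>\<bar>y\<bar>\<close>, and with it \<open>\<bar>x\<bar>\<close>, is bounded by a multiple
    of \<open>\<bar>x - y\<bar>\<close>.\<close>
  define t where "t = (1 + \<eta>) powr (1 / p) - 1"
  have "1 powr (1 / p) < (1 + \<eta>) powr (1 / p)" using assms by (intro powr_less_mono2) auto
  then have t: "0 < t" by (simp add: t_def)
  have t_powr: "(1 + t) powr p = 1 + \<eta>" using assms by (simp add: t_def powr_powr)
  define K where "K = (1 + 1 / t) powr p"
  have K: "0 \<le> K" by (simp add: K_def)
  have "\<bar>x\<bar> powr p \<le> (1 + \<eta>) * \<bar>y\<bar> powr p + K * \<bar>x - y\<bar> powr p" for x y
  proof (cases "\<bar>x - y\<bar> \<le> t * \<bar>y\<bar>")
    case True
    then have "\<bar>x\<bar> \<le> (1 + t) * \<bar>y\<bar>" by (simp add: algebra_simps)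
    then have "\<bar>x\<bar> powr p \<le> ((1 + t) * \<bar>y\<bar>) powr p" using assms by (intro powr_mono2) auto
    also have "\<dots> = (1 + \<eta>) * \<bar>y\<bar> powr p" using t by (simp add: powr_mult t_powr)
    finally show ?thesis using K by (simp add: add_increasing2)
  next
    case False
    then have "\<bar>y\<bar> \<le> \<bar>x - y\<bar> / t" using t by (simp add: field_simps)
    then have "\<bar>x\<bar> \<le> (1 + 1 / t) * \<bar>x - y\<bar>" by (simp add: algebra_simps)
    then have "\<bar>x\<bar> powr p \<le> ((1 + 1 / t) * \<bar>x - y\<bar>) powr p"
      using assms by (intro powr_mono2) auto
    also have "\<dots> = K * \<bar>x - y\<bar> powr p" using t by (simp add: powr_mult K_def)
    finally show ?thesis using assms by (simp add: add_increasing)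
  qed
  with K show thesis by (rule that)
qed

lemma moment_coupling_le:
  assumes \<pi>: "\<pi> \<in> couplings Q P" and "0 \<le> \<eta>" "0 \<le> K"
    and le: "\<And>x y. \<bar>x\<bar> powr p \<le> (1 + \<eta>) * \<bar>y\<bar> powr p + K * \<bar>x - y\<bar> powr p"
  shows "moment p Q \<le> ennreal (1 + \<eta>) * moment p P
      + ennreal K * (\<integral>\<^sup>+z. ennreal (\<bar>fst z - snd z\<bar> powr p) \<partial>\<pi>)"
    and "moment p P \<le> ennreal (1 + \<eta>) * moment p Q
      + ennreal K * (\<integral>\<^sup>+z. ennreal (\<bar>fst z - snd z\<bar> powr p) \<partial>\<pi>)"
proof -
  have sets_\<pi>: "sets \<pi> = sets borel" using \<pi> by (simp add: couplings_def)
  note [measurable] = borel_pair_measurable[OF sets_\<pi>]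
  have Q: "moment p Q = (\<integral>\<^sup>+z. ennreal (\<bar>fst z\<bar> powr p) \<partial>\<pi>)"
    unfolding moment_def
    by (rule coupling_nn_integral_fst[OF \<pi>, of "\<lambda>x. ennreal (\<bar>x\<bar> powr p)", symmetric]) simp
  have P: "moment p P = (\<integral>\<^sup>+z. ennreal (\<bar>snd z\<bar> powr p) \<partial>\<pi>)"
    unfolding moment_def
    by (rule coupling_nn_integral_snd[OF \<pi>, of "\<lambda>x. ennreal (\<bar>x\<bar> powr p)", symmetric]) simp
  have le': "ennreal (\<bar>x\<bar> powr p)
      \<le> ennreal (1 + \<eta>) * ennreal (\<bar>y\<bar> powr p) + ennreal K * ennreal (\<bar>x - y\<bar> powr p)" for x y
    using le[of x y] assms(2,3)
    by (simp add: ennreal_mult[symmetric] ennreal_plus[symmetric] ennreal_leI del: ennreal_plus)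
  have "(\<integral>\<^sup>+z. ennreal (\<bar>fst z\<bar> powr p) \<partial>\<pi>) \<le> (\<integral>\<^sup>+z. ennreal (1 + \<eta>) * ennreal (\<bar>snd z\<bar> powr p)
      + ennreal K * ennreal (\<bar>fst z - snd z\<bar> powr p) \<partial>\<pi>)"
    by (intro nn_integral_mono le')
  then show "moment p Q \<le> ennreal (1 + \<eta>) * moment p P
      + ennreal K * (\<integral>\<^sup>+z. ennreal (\<bar>fst z - snd z\<bar> powr p) \<partial>\<pi>)"
    unfolding Q P by (simp add: nn_integral_add nn_integral_cmult)
  have "(\<integral>\<^sup>+z. ennreal (\<bar>snd z\<bar> powr p) \<partial>\<pi>) \<le> (\<integral>\<^sup>+z. ennreal (1 + \<eta>) * ennreal (\<bar>fst z\<bar> powr p)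
      + ennreal K * ennreal (\<bar>fst z - snd z\<bar> powr p) \<partial>\<pi>)"
    by (intro nn_integral_mono) (metis le' abs_minus_commute)
  then show "moment p P \<le> ennreal (1 + \<eta>) * moment p Q
      + ennreal K * (\<integral>\<^sup>+z. ennreal (\<bar>fst z - snd z\<bar> powr p) \<partial>\<pi>)"
    unfolding Q P by (simp add: nn_integral_add nn_integral_cmult)
qed

lemma moment_finite_of_wasserstein:
  assumes "wasserstein p Q P < ennreal \<epsilon>" "moment p P < \<infinity>" "0 < p" "0 < \<epsilon>"
  shows "moment p Q < \<infinity>"
proof -
  obtain K where K: "0 \<le> K"
    "\<And>x y. \<bar>x\<bar> powr p \<le> (1 + 1) * \<bar>y\<bar> powr p + K * \<bar>x - y\<bar> powr p"
    using powr_abs_le_perturb[of p 1] assms(3) by auto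
  obtain \<pi> where \<pi>: "\<pi> \<in> couplings Q P"
    and cost: "(\<integral>\<^sup>+z. ennreal (\<bar>fst z - snd z\<bar> powr p) \<partial>\<pi>) < ennreal (\<epsilon> powr p)"
    using assms(1) unfolding wasserstein_less_iff[OF assms(3,4)] by blast
  have "(\<integral>\<^sup>+z. ennreal (\<bar>fst z - snd z\<bar> powr p) \<partial>\<pi>) < \<infinity>"
    using cost by (rule order_less_trans) simp
  then have "ennreal (1 + 1) * moment p P
      + ennreal K * (\<integral>\<^sup>+z. ennreal (\<bar>fst z - snd z\<bar> powr p) \<partial>\<pi>) < \<infinity>"
    using assms(2) by (simp add: ennreal_mult_less_top)
  with moment_coupling_le(1)[OF \<pi> _ K] show ?thesis
    by (meson order_le_less_trans zero_le_one)
qed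

text \<open>An infinite value is at infinite distance from a finite one. Hence a law of infinite
  moment violates every real bound on the moment deviation.\<close>

lemma enn2ereal_diff_le_iff:
  assumes "b < \<infinity>"
  shows "\<bar>enn2ereal a - enn2ereal b\<bar> \<le> ereal \<delta> \<longleftrightarrow> a < \<infinity> \<and> \<bar>enn2real a - enn2real b\<bar> \<le> \<delta>"
  using assms by (cases a; cases b) (auto simp: enn2ereal_ennreal)

lemma wasserstein_controls_moment:
  assumes fin: "moment p P < \<infinity>" and p: "0 < p" and \<epsilon>: "0 < \<epsilon>"
  obtains \<delta> where "0 < \<delta>"
    "\<And>Q. wasserstein p Q P < ennreal \<delta> \<Longrightarrow> \<bar>enn2ereal (moment p Q) - enn2ereal (moment p P)\<bar> \<le> ereal \<epsilon>"
proof -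
  obtain m where m: "moment p P = ennreal m" "0 \<le> m" using fin by (cases "moment p P") auto
  \<comment> \<open>The number \<open>\<eta>\<close> is fixed before \<open>K\<close>, and
    \<open>\<delta>\<close> after it; adding 1 in the denominators covers \<open>m = 0\<close> and
    \<open>K = 0\<close>. Both \<open>\<eta> * m\<close> and \<open>K * c\<close> cost a quarter of
    \<open>\<epsilon>\<close>. In the reverse inequality \<open>\<eta> * m'\<close> may cost three
    quarters, which still leaves one for \<open>K * c\<close>.\<close>
  define \<eta> where "\<eta> = min 1 (\<epsilon> / (4 * (m + 1)))"
  have \<eta>: "0 < \<eta>" "\<eta> \<le> 1" using m \<epsilon> by (auto simp: \<eta>_def)
  have "\<eta> * m \<le> \<epsilon> / (4 * (m + 1)) * m" using m by (intro mult_right_mono) (auto simp: \<eta>_def)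
  also have "\<dots> \<le> \<epsilon> / 4" using m \<epsilon> by (simp add: field_simps)
  finally have \<eta>m: "\<eta> * m \<le> \<epsilon> / 4" .
  obtain K where K: "0 \<le> K"
    "\<And>x y. \<bar>x\<bar> powr p \<le> (1 + \<eta>) * \<bar>y\<bar> powr p + K * \<bar>x - y\<bar> powr p"
    using powr_abs_le_perturb[OF p \<eta>(1)] by blast
  define \<delta> where "\<delta> = (\<epsilon> / (4 * (K + 1))) powr (1 / p)"
  have \<delta>: "0 < \<delta>" "\<delta> powr p = \<epsilon> / (4 * (K + 1))"
    using K \<epsilon> p by (auto simp: \<delta>_def powr_powr)
  show thesis
  proof (rule that[OF \<delta>(1)])
    fix Q assume W: "wasserstein p Q P < ennreal \<delta>"
    then obtain \<pi> where \<pi>: "\<pi> \<in> couplings Q P"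
      and cost: "(\<integral>\<^sup>+z. ennreal (\<bar>fst z - snd z\<bar> powr p) \<partial>\<pi>) < ennreal (\<delta> powr p)"
      unfolding wasserstein_less_iff[OF p \<delta>(1)] by blast
    from cost obtain c where c: "(\<integral>\<^sup>+z. ennreal (\<bar>fst z - snd z\<bar> powr p) \<partial>\<pi>) = ennreal c" "0 \<le> c"
      by (cases "\<integral>\<^sup>+z. ennreal (\<bar>fst z - snd z\<bar> powr p) \<partial>\<pi>") auto
    have "c \<le> \<epsilon> / (4 * (K + 1))" using cost \<delta>(2) c by (simp add: ennreal_less_iff)
    then have "K * c \<le> K * (\<epsilon> / (4 * (K + 1)))" using K(1) by (rule mult_left_mono)
    also have "\<dots> \<le> \<epsilon> / 4" using K \<epsilon> by (simp add: field_simps)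
    finally have Kc: "K * c \<le> \<epsilon> / 4" .
    note le = moment_coupling_le[OF \<pi> less_imp_le[OF \<eta>(1)] K, unfolded c m]
    obtain m' where m': "moment p Q = ennreal m'" "0 \<le> m'"
      using moment_finite_of_wasserstein[OF W fin p \<delta>(1)] by (cases "moment p Q") auto
    have 1: "m' \<le> (1 + \<eta>) * m + K * c"
      using le(1) m m' c K \<eta>
      by (simp add: ennreal_mult[symmetric] ennreal_plus[symmetric] del: ennreal_plus)
    have 2: "m \<le> (1 + \<eta>) * m' + K * c"
      using le(2) m m' c K \<eta>
      by (simp add: ennreal_mult[symmetric] ennreal_plus[symmetric] del: ennreal_plus)
    have "\<eta> * m' \<le> \<eta> * ((1 + \<eta>) * m + K * c)" using 1 \<eta> by (intro mult_left_mono) auto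
    also have "\<dots> = \<eta> * m + \<eta> * (\<eta> * m) + \<eta> * (K * c)" by (simp add: algebra_simps)
    also have "\<dots> \<le> \<eta> * m + 1 * (\<eta> * m) + 1 * (K * c)"
      using \<eta> m K c by (intro add_mono mult_right_mono order_refl) auto
    finally have "\<eta> * m' \<le> 3 / 4 * \<epsilon>" using \<eta>m Kc by simp
    then have "\<bar>m' - m\<bar> \<le> \<epsilon>" using 1 2 \<eta>m Kc \<epsilon> by (simp add: algebra_simps abs_le_iff)
    then show "\<bar>enn2ereal (moment p Q) - enn2ereal (moment p P)\<bar> \<le> ereal \<epsilon>"
      using m m' by (simp add: enn2ereal_ennreal)
  qed
qed

section \<open>Neighbourhoods given by finitely many inequalities, and measurability\<close>

text \<open>Counterexamples at every stage \<open>n\<close>, with tolerance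
  \<open>1 / (n + 1)\<close> and the first \<open>n + 1\<close> rationals of an enumeration, would
  form a sequence that converges in the required sense but stays outside the ball. The finiteness of
  \<open>R\<close> matters because vanishing in probability passes to finite unions.\<close>

lemma wasserstein_nhd:
  assumes P: "real_distribution P" "\<And>x. measure P {x} = 0" "moment p P < \<infinity>"
    and p: "0 < p" and \<epsilon>: "0 < \<epsilon>"
  obtains \<delta> R where "0 < \<delta>" "finite R"
    "\<And>Q. real_distribution Q \<Longrightarrow> \<bar>enn2ereal (moment p Q) - enn2ereal (moment p P)\<bar> \<le> ereal \<delta> \<Longrightarrow>
      (\<And>r. r \<in> R \<Longrightarrow> \<bar>cdf Q r - cdf P r\<bar> \<le> \<delta>) \<Longrightarrow> wasserstein p Q P < ennreal \<epsilon>"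
proof (rule ccontr)
  assume not: "\<not> thesis"
  define \<delta> where "\<delta> n = inverse (real (Suc n))" for n
  define R where "R n = from_nat_into (\<rat> :: real set) ` {..n}" for n
  have \<delta>: "0 < \<delta> n" for n by (simp add: \<delta>_def)
  have \<delta>_lim: "\<delta> \<longlonglongrightarrow> 0" unfolding \<delta>_def by (rule LIMSEQ_inverse_real_of_nat)
  have "\<exists>Q. real_distribution Q \<and> \<bar>enn2ereal (moment p Q) - enn2ereal (moment p P)\<bar> \<le> ereal (\<delta> n)
      \<and> (\<forall>r\<in>R n. \<bar>cdf Q r - cdf P r\<bar> \<le> \<delta> n) \<and> \<not> wasserstein p Q P < ennreal \<epsilon>" for n
    using not that[of "\<delta> n" "R n"] \<delta>[of n] by (auto simp: R_def)
  then obtain Q where Q: "\<And>n. real_distribution (Q n)"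
      "\<And>n. \<bar>enn2ereal (moment p (Q n)) - enn2ereal (moment p P)\<bar> \<le> ereal (\<delta> n)"
      "\<And>n r. r \<in> R n \<Longrightarrow> \<bar>cdf (Q n) r - cdf P r\<bar> \<le> \<delta> n"
      "\<And>n. \<not> wasserstein p (Q n) P < ennreal \<epsilon>"
    by metis
  have "(\<lambda>n. cdf (Q n) r) \<longlonglongrightarrow> cdf P r" if "r \<in> \<rat>" for r
  proof (rule LIM_zero_cancel, rule Lim_null_comparison[OF _ \<delta>_lim])
    obtain k where "r = from_nat_into \<rat> k"
      using from_nat_into_surj[OF countable_rat \<open>r \<in> \<rat>\<close>] by metis
    then have "r \<in> R n" if "k \<le> n" for n using that by (auto simp: R_def)
    then show "\<forall>\<^sub>F n in sequentially. norm (cdf (Q n) r - cdf P r) \<le> \<delta> n"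
      using Q(3) by (auto simp: eventually_sequentially)
  qed
  moreover have "(\<lambda>n. moment p (Q n)) \<longlonglongrightarrow> moment p P"
  proof -
    have real: "moment p (Q n) < \<infinity>" "\<bar>enn2real (moment p (Q n)) - enn2real (moment p P)\<bar> \<le> \<delta> n" for n
      using Q(2)[of n] by (simp_all add: enn2ereal_diff_le_iff[OF P(3)])
    have "(\<lambda>n. enn2real (moment p (Q n))) \<longlonglongrightarrow> enn2real (moment p P)"
      by (rule LIM_zero_cancel, rule Lim_null_comparison[OF _ \<delta>_lim]) (simp add: real)
    from tendsto_ennrealI[OF this] show ?thesis
      using real(1) P(3) by (simp only: ennreal_enn2real infinity_ennreal_def)
  qed
  moreover have "wasserstein p P P < ennreal \<epsilon>"
  proof -
    interpret P: real_distribution P by fact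
    show ?thesis by (rule wasserstein_self) (use p \<epsilon> P.prob_space_axioms in auto)
  qed
  ultimately have "\<forall>\<^sub>F n in sequentially. wasserstein p (Q n) P < ennreal \<epsilon>"
    using Q(1) P p \<epsilon> by (intro wasserstein_eventually_less)
  then show False using Q(4) by simp
qed

text \<open>By sequential openness, membership in \<open>{W\<^sub>p < \<epsilon>}\<close> is decided, among laws with finite moment,
  by whether the sequence of the moment and the distribution function at the rationals avoids a
  closed set.\<close>

lemma wasserstein_ge_measurable:
  fixes Q :: "'s \<Rightarrow> real measure"
  assumes Q: "\<And>s. s \<in> space S \<Longrightarrow> real_distribution (Q s)"
      "\<And>s x. s \<in> space S \<Longrightarrow> measure (Q s) {x} = 0"
    and [measurable]: "(\<lambda>s. moment p (Q s)) \<in> borel_measurable S"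
    and [measurable]: "\<And>r. (\<lambda>s. cdf (Q s) r) \<in> borel_measurable S"
    and P: "moment p P < \<infinity>" and p: "0 < p" and \<epsilon>: "0 < \<epsilon>"
  shows "{s \<in> space S. ennreal \<epsilon> \<le> wasserstein p (Q s) P} \<in> sets S"
proof -
  \<comment> \<open>The law becomes a point of a sequence space: coordinate 0 is the moment, the
    others are the values of the distribution function at the rationals. As \<open>enn2real\<close>
    sends an infinite moment to 0, \<open>B\<close> collects only laws of finite moment and the
    others are treated separately.\<close>
  define \<Psi> where "\<Psi> s n = (case n of 0 \<Rightarrow> enn2real (moment p (Q s))
      | Suc k \<Rightarrow> cdf (Q s) (from_nat_into \<rat> k))" for s n
  have [measurable]: "\<Psi> \<in> borel_measurable S"
  proof (rule measurable_coordinatewise_then_product)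
    show "(\<lambda>s. \<Psi> s n) \<in> borel_measurable S" for n
      unfolding \<Psi>_def by (cases n) simp_all
  qed
  define B where "B = {s \<in> space S. moment p (Q s) < \<infinity> \<and> ennreal \<epsilon> \<le> wasserstein p (Q s) P}"
  \<comment> \<open>Were \<open>s\<close> inside the open ball, the members of \<open>B\<close>
    approximating it coordinatewise would eventually be inside as well.\<close>
  have closed: "ennreal \<epsilon> \<le> wasserstein p (Q s) P"
    if s: "s \<in> space S" "moment p (Q s) < \<infinity>" "\<Psi> s \<in> closure (\<Psi> ` B)" for s
  proof (rule ccontr)
    assume not: "\<not> ennreal \<epsilon> \<le> wasserstein p (Q s) P"
    obtain x where x: "\<And>n. x n \<in> \<Psi> ` B" "x \<longlonglongrightarrow> \<Psi> s"
      using s(3) unfolding closure_sequential by blast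
    then have "\<forall>n. \<exists>t. t \<in> B \<and> x n = \<Psi> t" by auto
    from choice[OF this] obtain t where t: "\<And>n. t n \<in> B" "\<And>n. x n = \<Psi> (t n)" by auto
    have coord: "(\<lambda>n. \<Psi> (t n) i) \<longlonglongrightarrow> \<Psi> s i" for i
    proof -
      have "continuous_on UNIV (\<lambda>y :: nat \<Rightarrow> real. y i)" by (rule continuous_on_product_coordinates)
      then have "((\<lambda>n. (x n) i) \<longlonglongrightarrow> \<Psi> s i)"
        by (rule continuous_on_tendsto_compose[OF _ x(2)]) auto
      then show ?thesis by (simp add: t(2))
    qed
    have "(\<lambda>n. cdf (Q (t n)) r) \<longlonglongrightarrow> cdf (Q s) r" if "r \<in> \<rat>" for r
    proof -
      obtain k where "r = from_nat_into \<rat> k"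
        using from_nat_into_surj[OF countable_rat \<open>r \<in> \<rat>\<close>] by metis
      then show ?thesis using coord[of "Suc k"] by (simp add: \<Psi>_def)
    qed
    moreover have "(\<lambda>n. moment p (Q (t n))) \<longlonglongrightarrow> moment p (Q s)"
    proof -
      have "moment p (Q (t n)) < top" for n using t(1) by (simp add: B_def)
      then show ?thesis
        using tendsto_ennrealI[OF coord[of 0]] s(2)
        by (simp only: \<Psi>_def nat.case ennreal_enn2real infinity_ennreal_def)
    qed
    ultimately have "\<forall>\<^sub>F n in sequentially. wasserstein p (Q (t n)) P < ennreal \<epsilon>"
      using Q s t(1) P p \<epsilon> not by (intro wasserstein_eventually_less[where Q = "Q s"]) (auto simp: B_def)
    then show False using t(1) by (simp add: B_def not_le[symmetric])
  qed
  have "{s \<in> space S. ennreal \<epsilon> \<le> wasserstein p (Q s) P}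
    = {s \<in> space S. moment p (Q s) = \<infinity> \<or> \<Psi> s \<in> closure (\<Psi> ` B)}"
  proof (intro Collect_cong conj_cong refl iffI)
    fix s assume s: "s \<in> space S" and "ennreal \<epsilon> \<le> wasserstein p (Q s) P"
    then have "s \<in> B" if "moment p (Q s) < \<infinity>" using that by (simp add: B_def)
    then show "moment p (Q s) = \<infinity> \<or> \<Psi> s \<in> closure (\<Psi> ` B)"
      using closure_subset[of "\<Psi> ` B"]
      by (cases "moment p (Q s) = \<infinity>") (auto simp: less_top[symmetric])
  next
    fix s assume s: "s \<in> space S" and "moment p (Q s) = \<infinity> \<or> \<Psi> s \<in> closure (\<Psi> ` B)"
    then show "ennreal \<epsilon> \<le> wasserstein p (Q s) P"
      using closed[OF s] moment_finite_of_wasserstein[OF _ P p \<epsilon>, of "Q s"]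
      by (auto simp: less_top[symmetric] not_less[symmetric])
  qed
  also have "\<dots> \<in> sets S"
  proof -
    \<comment> \<open>A closure is Borel whatever \<open>B\<close> is, so its preimage under
      \<open>\<Psi>\<close> is measurable although nothing is known about \<open>B\<close>
      itself.\<close>
    have [measurable]: "closure (\<Psi> ` B) \<in> sets borel" by simp
    show ?thesis by measurable
  qed
  finally show ?thesis .
qed

section \<open>Posterior consistency\<close>

lemma prob_densityD:
  assumes "prob_density q"
  shows "q \<in> borel_measurable borel" "0 \<le> q x" "(\<integral>\<^sup>+x. ennreal (q x) \<partial>lborel) = 1"
  using assms by (auto simp: prob_density_def)

lemma real_distribution_density_measure:
  assumes "prob_density q"
  shows "real_distribution (density_measure q)" "measure (density_measure q) {x} = 0"
proof -
  note [measurable] = prob_densityD(1)[OF assms]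
  have "prob_space (density_measure q)"
    by (rule prob_spaceI) (simp add: density_measure_def emeasure_density prob_densityD[OF assms])
  then show "real_distribution (density_measure q)"
    by (simp add: real_distribution_def real_distribution_axioms_def density_measure_def)
  have "emeasure (density_measure q) {x} = 0"
    by (auto simp: density_measure_def emeasure_density nn_integral_0_iff_AE
        intro!: AE_mp[OF AE_lborel_singleton[of x]])
  then show "measure (density_measure q) {x} = 0" by (simp add: measure_def)
qed

lemma nn_integral_density_measure:
  assumes "prob_density q" and [measurable]: "f \<in> borel_measurable borel"
  shows "(\<integral>\<^sup>+x. f x \<partial>density_measure q) = (\<integral>\<^sup>+x. ennreal (q x) * f x \<partial>lborel)"
  using prob_densityD(1)[OF assms(1)] by (simp add: density_measure_def nn_integral_density)

lemma AE_density_measure_pos: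
  assumes "prob_density q"
  shows "AE x in density_measure q. 0 < q x"
  using prob_densityD[OF assms] unfolding density_measure_def by (simp add: AE_density less_le)

lemma log_ratio_measurable [measurable]:
  assumes [measurable]: "f \<in> borel_measurable N" "g \<in> borel_measurable N"
  shows "(\<lambda>x. log_ratio (f x) (g x)) \<in> borel_measurable N"
  unfolding log_ratio_def by measurable

text \<open>With \<open>s = ln (b / a)\<close>, the case \<open>s > 0\<close> is
  \<open>(s - \<delta>)\<^sup>2 \<ge> 0\<close> combined with
  \<open>exp s \<ge> 1 + s + s\<^sup>2 / 2\<close>, and the case of positive
  \<open>b \<le> a\<close> is \<open>ln x \<le> x - 1\<close>. All terms stand on the side where
  they are positive, so integration needs no subtraction in \<open>ennreal\<close>. Integrated under
  the law with density \<open>a\<close>, the inequality bounds the negative part of the log-ratio by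
  the divergence; the second claim shows beforehand that this part is finite.\<close>

lemma log_ratio_tangent:
  fixes a b \<delta> :: real
  assumes "0 < a" "0 \<le> b" "0 \<le> \<delta>"
  shows "ennreal (1 + \<delta>) * e2ennreal (- log_ratio a b) + 1
      \<le> ennreal (\<delta>\<^sup>2 / 2) + ennreal (b / a) + e2ennreal (log_ratio a b)"
    and "e2ennreal (- log_ratio a b) \<le> ennreal (b / a)"
proof -
  consider "b = 0" | "0 < b" "b \<le> a" | "0 < b" "a < b" using assms by linarith
  then have "ennreal (1 + \<delta>) * e2ennreal (- log_ratio a b) + 1
      \<le> ennreal (\<delta>\<^sup>2 / 2) + ennreal (b / a) + e2ennreal (log_ratio a b)
      \<and> e2ennreal (- log_ratio a b) \<le> ennreal (b / a)"
  proof cases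
    case 1
    then show ?thesis by (simp add: log_ratio_def e2ennreal_neg)
  next
    case 2
    have ln0: "0 \<le> ln (a / b)" using 2 by simp
    have "ln (b / a) \<le> b / a - 1" using 2 assms by (intro ln_le_minus_one) simp
    then have "1 \<le> b / a + ln (a / b)" using 2 assms by (simp add: ln_div)
    then have "1 \<le> \<delta>\<^sup>2 / 2 + b / a + ln (a / b)"
      using zero_le_power2[of \<delta>] by linarith
    moreover have "e2ennreal (- log_ratio a b) = 0"
      using 2 ln0 by (simp add: log_ratio_def e2ennreal_neg ennreal_neg)
    ultimately show ?thesis
      using 2 ln0 assms
      by (simp add: log_ratio_def e2ennreal_ereal ennreal_plus[symmetric] ennreal_1[symmetric]
          ennreal_leI del: ennreal_plus ennreal_1)
  next
    case 3
    define s where "s = ln (b / a)"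
    have s: "0 \<le> s" "ln (a / b) = - s" "b / a = exp s"
      using 3 assms by (simp_all add: s_def) (simp add: ln_div)
    have "0 \<le> (s - \<delta>)\<^sup>2" by simp
    then have "(1 + \<delta>) * s + 1 \<le> \<delta>\<^sup>2 / 2 + (1 + s + s\<^sup>2 / 2)"
      by (simp add: power2_eq_square algebra_simps)
    also have "\<dots> \<le> \<delta>\<^sup>2 / 2 + exp s"
      using exp_lower_Taylor_quadratic[OF s(1)] by simp
    finally have "(1 + \<delta>) * s + 1 \<le> \<delta>\<^sup>2 / 2 + b / a" by (simp add: s)
    moreover have "e2ennreal (log_ratio a b) = 0"
      using 3 s by (simp add: log_ratio_def e2ennreal_neg ennreal_neg)
    moreover have "s \<le> b / a" unfolding s(3) using exp_ge_add_one_self[of s] by linarith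
    ultimately show ?thesis
      using 3 s assms
      by (simp add: log_ratio_def e2ennreal_ereal ennreal_plus[symmetric] ennreal_1[symmetric]
          ennreal_mult[symmetric] ennreal_leI del: ennreal_plus ennreal_1)
  qed
  then show "ennreal (1 + \<delta>) * e2ennreal (- log_ratio a b) + 1
      \<le> ennreal (\<delta>\<^sup>2 / 2) + ennreal (b / a) + e2ennreal (log_ratio a b)"
    and "e2ennreal (- log_ratio a b) \<le> ennreal (b / a)" by auto
qed

text \<open>Passing to the positive part only lowers the exponential, and a finite \<open>t\<close>
  excludes \<open>b = 0\<close>.\<close>

lemma exp_minus_le_ratio:
  assumes "0 < a" "0 \<le> b" "e2ennreal (log_ratio a b) = ennreal t" "0 \<le> t"
  shows "exp (- t) \<le> b / a"
proof -
  have "b \<noteq> 0" using assms(3) by (auto simp: log_ratio_def)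
  then have b: "0 < b" using assms by simp
  have "ennreal (ln (a / b)) \<le> ennreal t"
    using assms(3) b by (simp add: log_ratio_def e2ennreal_ereal)
  then have "ln (a / b) \<le> t" using assms(4) by simp
  then have "- t \<le> ln (b / a)" using assms b by (simp add: ln_div)
  then have "exp (- t) \<le> exp (ln (b / a))" by simp
  also have "\<dots> = b / a" using assms b by simp
  finally show ?thesis .
qed

text \<open>Let \<open>a\<close> and \<open>b\<close> be the integrals of the positive and the
  negative part. The tangent inequality gives
  \<open>\<delta> * b \<le> \<delta>\<^sup>2 / 2 + (a - b)\<close>, where \<open>a - b\<close> is
  the divergence. Hence \<open>b \<le> \<delta>\<close>, and adding the divergence back bounds
  \<open>a\<close>.\<close>

lemma KL_positive_part:
  assumes p: "prob_density p" and q: "prob_density q" and "0 < \<delta>"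
    and KL: "KL p q < ereal (\<delta>\<^sup>2 / 2)"
  shows "(\<integral>\<^sup>+x. e2ennreal (log_ratio (p x) (q x)) \<partial>density_measure p) \<le> ennreal (\<delta> + \<delta>\<^sup>2 / 2)"
proof -
  note [measurable] = prob_densityD(1)[OF p] prob_densityD(1)[OF q]
  interpret P: real_distribution "density_measure p"
    by (rule real_distribution_density_measure[OF p])
  let ?P = "density_measure p"
  define a where "a = (\<integral>\<^sup>+x. e2ennreal (log_ratio (p x) (q x)) \<partial>?P)"
  define b where "b = (\<integral>\<^sup>+x. e2ennreal (- log_ratio (p x) (q x)) \<partial>?P)"
  \<comment> \<open>Only an inequality: the mass that \<open>q\<close> puts where \<open>p\<close>
    vanishes is lost.\<close>
  have r: "(\<integral>\<^sup>+x. ennreal (q x / p x) \<partial>?P) \<le> 1"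
  proof -
    have "(\<integral>\<^sup>+x. ennreal (q x / p x) \<partial>?P) = (\<integral>\<^sup>+x. ennreal (p x) * ennreal (q x / p x) \<partial>lborel)"
      by (rule nn_integral_density_measure[OF p]) simp
    also have "\<dots> \<le> (\<integral>\<^sup>+x. ennreal (q x) \<partial>lborel)"
      using prob_densityD(2)[OF p] prob_densityD(2)[OF q]
      by (intro nn_integral_mono) (auto simp: ennreal_mult[symmetric] intro!: ennreal_leI)
    finally show ?thesis by (simp add: prob_densityD[OF q])
  qed
  have "b \<le> (\<integral>\<^sup>+x. ennreal (q x / p x) \<partial>?P)"
    unfolding b_def using AE_density_measure_pos[OF p]
    by (intro nn_integral_mono_AE)
      (auto elim!: eventually_mono intro!: log_ratio_tangent(2)[where \<delta> = 0] prob_densityD(2)[OF q])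
  with r have "b \<le> 1" by simp
  then obtain b' where b': "b = ennreal b'" "0 \<le> b'" by (cases b) (auto simp: top_unique)
  obtain a' where a': "a = ennreal a'" "0 \<le> a'"
    using KL unfolding KL_def a_def[symmetric] b_def[symmetric] b'(1)
    using b'(2) by (cases a) auto
  have ab: "a' - b' < \<delta>\<^sup>2 / 2"
    using KL unfolding KL_def a_def[symmetric] b_def[symmetric] a'(1) b'(1)
    using a'(2) b'(2) by (simp add: enn2ereal_ennreal)
  have "ennreal (1 + \<delta>) * b + 1 = (\<integral>\<^sup>+x. ennreal (1 + \<delta>) * e2ennreal (- log_ratio (p x) (q x)) + 1 \<partial>?P)"
    unfolding b_def by (simp add: nn_integral_add nn_integral_cmult P.emeasure_space_1[simplified])
  also have "\<dots> \<le> (\<integral>\<^sup>+x. ennreal (\<delta>\<^sup>2 / 2) + ennreal (q x / p x) + e2ennreal (log_ratio (p x) (q x)) \<partial>?P)"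
    using AE_density_measure_pos[OF p]
    by (intro nn_integral_mono_AE)
      (auto elim!: eventually_mono intro!: log_ratio_tangent(1) prob_densityD(2)[OF q] less_imp_le[OF \<open>0 < \<delta>\<close>])
  also have "\<dots> = ennreal (\<delta>\<^sup>2 / 2) + (\<integral>\<^sup>+x. ennreal (q x / p x) \<partial>?P) + a"
    unfolding a_def by (simp add: nn_integral_add P.emeasure_space_1[simplified])
  also have "\<dots> \<le> ennreal (\<delta>\<^sup>2 / 2) + 1 + a" by (intro add_mono r order_refl)
  finally have "(1 + \<delta>) * b' + 1 \<le> \<delta>\<^sup>2 / 2 + 1 + a'"
    using a' b' \<open>0 < \<delta>\<close>
    by (simp add: ennreal_plus[symmetric] ennreal_1[symmetric] ennreal_mult[symmetric]
        del: ennreal_plus ennreal_1)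
  then have "\<delta> * b' \<le> \<delta>\<^sup>2" using ab by (simp add: algebra_simps)
  then have "b' \<le> \<delta>" using \<open>0 < \<delta>\<close> by (simp add: power2_eq_square)
  then show ?thesis
    unfolding a_def[symmetric] a'(1) using ab by (intro ennreal_leI) simp
qed

section \<open>The posterior and integrals over the data\<close>

locale posterior_model = prob_space M for M :: "'a measure" +
  fixes X :: "nat \<Rightarrow> 'a \<Rightarrow> real" and p0 :: "real \<Rightarrow> real"
    and F :: "(real \<Rightarrow> real) set" and prior :: "nat \<Rightarrow> (real \<Rightarrow> real) measure"
  assumes p0: "prob_density p0"
    and indep: "indep_vars (\<lambda>_. borel) X UNIV"
    and distr_X: "\<And>i. distr M borel (X i) = density_measure p0"
    and model: "density_model F"
    and prior: "\<And>n. prior_on F (prior n)"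
begin

abbreviation P0 :: "real measure" where "P0 \<equiv> density_measure p0"

sublocale P0: real_distribution P0
  by (rule real_distribution_density_measure[OF p0])

sublocale prior: prob_space "prior n" for n
  using prior by (simp add: prior_on_def)

lemma sets_prior [measurable_cong]: "sets (prior n) = sets (weak_borel F)"
  using prior by (simp add: prior_on_def)

lemma space_prior: "space (prior n) = F"
  using sets_eq_imp_space_eq[OF sets_prior[of n]]
  by (simp add: weak_borel_def space_measure_of_conv)

lemma prob_density_model: "q \<in> F \<Longrightarrow> prob_density q"
  using model by (auto simp: density_model_def)

lemma p0_measurable [measurable]: "p0 \<in> borel_measurable borel"
  by (rule prob_densityD(1)[OF p0])

lemma X_measurable [measurable]: "X i \<in> borel_measurable M"
  using indep by (simp add: indep_vars_def)

lemma eval_measurable: "(\<lambda>z. fst z (snd z)) \<in> borel_measurable (prior n \<Otimes>\<^sub>M (borel :: real measure))"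
  using model by (simp add: density_model_def case_prod_beta' measurable_cong_sets[OF sets_pair_measure_cong[OF sets_prior refl] refl])

lemma eval_measurable' [measurable (raw)]:
  assumes "f \<in> N \<rightarrow>\<^sub>M prior n" "g \<in> borel_measurable N"
  shows "(\<lambda>z. f z (g z)) \<in> borel_measurable N"
  using measurable_compose[OF measurable_Pair[OF assms] eval_measurable] by simp

definition lik :: "nat \<Rightarrow> (real \<Rightarrow> real) \<Rightarrow> 'a \<Rightarrow> ennreal" where
  "lik n q \<omega> = ennreal (\<Prod>i<n. q (X i \<omega>) / p0 (X i \<omega>))"

lemma lik_measurable [measurable (raw)]:
  assumes [measurable]: "f \<in> N \<rightarrow>\<^sub>M prior n" "g \<in> N \<rightarrow>\<^sub>M M"
  shows "(\<lambda>z. lik m (f z) (g z)) \<in> borel_measurable N"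
  unfolding lik_def by measurable

lemma posterior_eq:
  "posterior p0 (prior n) n (\<lambda>i. X i \<omega>) A =
    enn2real ((\<integral>\<^sup>+q\<in>A. lik n q \<omega> \<partial>prior n) / (\<integral>\<^sup>+q. lik n q \<omega> \<partial>prior n))"
  by (simp add: posterior_def lik_def)

lemma posterior_measurable [measurable]:
  assumes [measurable]: "A \<in> sets (prior n)"
  shows "(\<lambda>\<omega>. posterior p0 (prior n) n (\<lambda>i. X i \<omega>) A) \<in> borel_measurable M"
  unfolding posterior_eq by measurable

lemma nn_integral_prod_X:
  assumes [measurable]: "g \<in> borel_measurable borel"
  shows "(\<integral>\<^sup>+\<omega>. (\<Prod>i<n. g (X i \<omega>)) \<partial>M) = (\<integral>\<^sup>+x. g x \<partial>P0) ^ n"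
proof -
  have "(\<integral>\<^sup>+\<omega>. (\<Prod>i<n. g (X i \<omega>)) \<partial>M) = (\<Prod>i<n. \<integral>\<^sup>+\<omega>. g (X i \<omega>) \<partial>M)"
    by (intro indep_vars_nn_integral indep_vars_compose2[OF indep_vars_subset[OF indep]]) auto
  also have "\<dots> = (\<Prod>i<n. \<integral>\<^sup>+x. g x \<partial>P0)"
  proof (rule prod.cong)
    show "(\<integral>\<^sup>+\<omega>. g (X i \<omega>) \<partial>M) = (\<integral>\<^sup>+x. g x \<partial>P0)" for i
      unfolding distr_X[of i, symmetric] by (simp add: nn_integral_distr)
  qed simp
  finally show ?thesis by simp
qed

lemma AE_p0_pos: "AE \<omega> in M. \<forall>i. 0 < p0 (X i \<omega>)"
proof (subst AE_all_countable, rule allI)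
  show "AE \<omega> in M. 0 < p0 (X i \<omega>)" for i
    using AE_density_measure_pos[OF p0] unfolding distr_X[of i, symmetric]
    by (subst (asm) AE_distr_iff) auto
qed

section \<open>Exponential bound for the numerator\<close>

text \<open>Weighting by the likelihood changes the data law to that of \<open>q\<close>, under
  which a frequency of \<open>B\<close> below \<open>c\<close> is a deviation by at least
  \<open>\<epsilon>\<close>. The Chernoff bound with tilt \<open>t\<close> has exponent
  \<open>- t * \<epsilon> + t\<^sup>2 / 2\<close> per observation, and \<open>t = \<epsilon>\<close>
  minimises it. The lemma serves for alternatives \<open>q\<close> and, with \<open>q = p0\<close>
  and the complement of \<open>B\<close>, for the true law.\<close>

lemma likelihood_lower_tail:
  assumes q: "prob_density q" and [measurable]: "B \<in> sets borel" and \<epsilon>: "0 \<le> \<epsilon>"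
    and sep: "c + \<epsilon> \<le> measure (density_measure q) B"
  shows "(\<integral>\<^sup>+\<omega>. lik n q \<omega> * indicator {\<omega>. (\<Sum>i<n. indicat_real B (X i \<omega>)) \<le> real n * c} \<omega> \<partial>M)
    \<le> ennreal (exp (- (\<epsilon>\<^sup>2 / 2) * real n))"
proof -
  interpret Q: real_distribution "density_measure q"
    by (rule real_distribution_density_measure[OF q])
  note [measurable] = prob_densityD(1)[OF q]
  note q0 = prob_densityD(2)[OF q] and p00 = prob_densityD(2)[OF p0]
  define G where "G = measure (density_measure q) B"
  \<comment> \<open>One factor of the exponentially tilted likelihood; on the event the product of
    the tilts is at least 1.\<close>
  define g where "g x = ennreal (exp (\<epsilon> * (c - indicat_real B x)) * (q x / p0 x))" for x
  have "(\<integral>\<^sup>+\<omega>. lik n q \<omega> * indicator {\<omega>. (\<Sum>i<n. indicat_real B (X i \<omega>)) \<le> real n * c} \<omega> \<partial>M)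
      \<le> (\<integral>\<^sup>+\<omega>. (\<Prod>i<n. g (X i \<omega>)) \<partial>M)"
  proof (intro nn_integral_mono)
    fix \<omega>
    let ?S = "\<Sum>i<n. indicat_real B (X i \<omega>)"
    have "(\<Prod>i<n. g (X i \<omega>)) = ennreal (\<Prod>i<n. exp (\<epsilon> * (c - indicat_real B (X i \<omega>))) * (q (X i \<omega>) / p0 (X i \<omega>)))"
      unfolding g_def using q0 p00 by (intro prod_ennreal) auto
    also have "(\<Prod>i<n. exp (\<epsilon> * (c - indicat_real B (X i \<omega>))) * (q (X i \<omega>) / p0 (X i \<omega>)))
        = exp (\<epsilon> * (real n * c - ?S)) * (\<Prod>i<n. q (X i \<omega>) / p0 (X i \<omega>))"
      by (simp only: prod.distrib exp_sum[symmetric] finite_lessThan sum_distrib_left[symmetric] sum_subtractf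
          sum_constant card_lessThan)
    also have "ennreal \<dots> = ennreal (exp (\<epsilon> * (real n * c - ?S))) * lik n q \<omega>"
      unfolding lik_def by (rule ennreal_mult') simp
    finally have eq: "(\<Prod>i<n. g (X i \<omega>)) = ennreal (exp (\<epsilon> * (real n * c - ?S))) * lik n q \<omega>" .
    show "lik n q \<omega> * indicator {\<omega>. (\<Sum>i<n. indicat_real B (X i \<omega>)) \<le> real n * c} \<omega>
      \<le> (\<Prod>i<n. g (X i \<omega>))"
    proof (cases "?S \<le> real n * c")
      case True
      have "1 * lik n q \<omega> \<le> ennreal (exp (\<epsilon> * (real n * c - ?S))) * lik n q \<omega>"
        using True \<epsilon> by (intro mult_right_mono) (auto simp: ennreal_1[symmetric] simp del: ennreal_1)
      then show ?thesis using True by (simp add: eq)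
    qed simp
  qed
  also have "\<dots> = (\<integral>\<^sup>+x. g x \<partial>P0) ^ n"
    by (rule nn_integral_prod_X) (simp add: g_def)
  also have "\<dots> \<le> ennreal (exp (- (\<epsilon>\<^sup>2 / 2))) ^ n"
  proof (rule power_mono)
    have "(\<integral>\<^sup>+x. g x \<partial>P0) = (\<integral>\<^sup>+x. ennreal (p0 x) * g x \<partial>lborel)"
      by (rule nn_integral_density_measure[OF p0]) (simp add: g_def)
    also have "\<dots> \<le> (\<integral>\<^sup>+x. ennreal (q x) * ennreal (exp (\<epsilon> * (c - indicat_real B x))) \<partial>lborel)"
      unfolding g_def using q0 p00
      by (intro nn_integral_mono) (auto simp: ennreal_mult[symmetric] intro!: ennreal_leI)
    also have "\<dots> = (\<integral>\<^sup>+x. ennreal (exp (\<epsilon> * (c - indicat_real B x))) \<partial>density_measure q)"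
      by (rule nn_integral_density_measure[OF q, symmetric]) simp
    also have "\<dots> = (\<integral>\<^sup>+x. ennreal (exp (\<epsilon> * c)) * indicator (- B) x
        + ennreal (exp (\<epsilon> * c - \<epsilon>)) * indicator B x \<partial>density_measure q)"
      by (intro nn_integral_cong) (auto simp: indicator_def algebra_simps)
    also have "\<dots> = ennreal (exp (\<epsilon> * c)) * emeasure (density_measure q) (- B)
        + ennreal (exp (\<epsilon> * c - \<epsilon>)) * emeasure (density_measure q) B"
      by (subst nn_integral_add) (auto simp: nn_integral_cmult)
    also have "\<dots> = ennreal (exp (\<epsilon> * c) * (1 - G) + exp (\<epsilon> * c - \<epsilon>) * G)"
      using Q.prob_compl[of B]
      by (simp add: Q.emeasure_eq_measure G_def ennreal_mult[symmetric] ennreal_plus[symmetric]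
          Compl_eq_Diff_UNIV del: ennreal_plus)
    also have "\<dots> \<le> ennreal (exp (- (\<epsilon>\<^sup>2 / 2)))"
    proof (rule ennreal_leI)
      have G: "0 \<le> G" "G \<le> 1" by (simp_all add: G_def)
      have "exp (- \<epsilon>) \<le> 1 - \<epsilon> + \<epsilon>\<^sup>2 / 2"
      proof -
        \<comment> \<open>The expansion stops before the cubic term, whose value at a negative
          argument is nonpositive.\<close>
        have "\<exists>t. \<bar>t\<bar> \<le> \<bar>- \<epsilon>\<bar> \<and> exp (- \<epsilon>) = (\<Sum>m<3. (- \<epsilon>) ^ m / fact m) + exp t / fact 3 * (- \<epsilon>) ^ 3"
          by (rule Maclaurin_exp_le)
        then obtain t where "exp (- \<epsilon>) = (\<Sum>m<3. (- \<epsilon>) ^ m / fact m) + exp t / fact 3 * (- \<epsilon>) ^ 3"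
          by blast
        moreover have "exp t / fact 3 * (- \<epsilon>) ^ 3 \<le> 0"
          using \<epsilon> by (intro mult_nonneg_nonpos) auto
        ultimately show ?thesis by (simp add: eval_nat_numeral)
      qed
      then have "G * exp (- \<epsilon>) \<le> G * (1 - \<epsilon> + \<epsilon>\<^sup>2 / 2)" using G by (intro mult_left_mono)
      then have "(1 - G) + exp (- \<epsilon>) * G \<le> 1 + (- G * \<epsilon> + G * (\<epsilon>\<^sup>2 / 2))"
        by (simp add: algebra_simps)
      also have "\<dots> \<le> exp (- G * \<epsilon> + G * (\<epsilon>\<^sup>2 / 2))" by (rule exp_ge_add_one_self)
      also have "\<dots> \<le> exp (- (c + \<epsilon>) * \<epsilon> + 1 * (\<epsilon>\<^sup>2 / 2))"
      proof -
        have "(c + \<epsilon>) * \<epsilon> \<le> G * \<epsilon>" "G * (\<epsilon>\<^sup>2 / 2) \<le> 1 * (\<epsilon>\<^sup>2 / 2)"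
          using sep G \<epsilon> by (intro mult_right_mono; simp add: G_def)+
        then have "- G * \<epsilon> + G * (\<epsilon>\<^sup>2 / 2) \<le> - (c + \<epsilon>) * \<epsilon> + 1 * (\<epsilon>\<^sup>2 / 2)"
          by linarith
        then show ?thesis by (simp only: exp_le_cancel_iff)
      qed
      finally have "exp (\<epsilon> * c) * ((1 - G) + exp (- \<epsilon>) * G)
          \<le> exp (\<epsilon> * c) * exp (- (c + \<epsilon>) * \<epsilon> + 1 * (\<epsilon>\<^sup>2 / 2))"
        by (intro mult_left_mono) auto
      also have "\<dots> = exp (- (\<epsilon>\<^sup>2 / 2))"
        by (subst exp_add[symmetric], rule arg_cong[of _ _ exp]) (simp add: power2_eq_square field_simps)
      finally show "exp (\<epsilon> * c) * (1 - G) + exp (\<epsilon> * c - \<epsilon>) * G \<le> exp (- (\<epsilon>\<^sup>2 / 2))"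
        unfolding diff_conv_add_uminus[of "\<epsilon> * c"] exp_add by (simp only: distrib_left mult.assoc)
    qed
    finally show "(\<integral>\<^sup>+x. g x \<partial>P0) \<le> ennreal (exp (- (\<epsilon>\<^sup>2 / 2)))" .
  qed simp
  also have "\<dots> = ennreal (exp (- (\<epsilon>\<^sup>2 / 2) * real n))"
    by (simp add: ennreal_power exp_of_nat2_mult[symmetric] mult.commute)
  finally show ?thesis .
qed

section \<open>Lower bound for the denominator\<close>

text \<open>Only positive parts are summed: this keeps the sum nonnegative, as Tonelli and Markov
  require, and gives the value \<open>\<infinity>\<close> a meaning when \<open>q\<close> vanishes
  at an observation with \<open>p0\<close> positive.\<close>

definition loss :: "nat \<Rightarrow> (real \<Rightarrow> real) \<Rightarrow> 'a \<Rightarrow> ennreal" where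
  "loss n q \<omega> = (\<Sum>i<n. e2ennreal (log_ratio (p0 (X i \<omega>)) (q (X i \<omega>))))"

lemma loss_measurable [measurable (raw)]:
  assumes [measurable]: "f \<in> N \<rightarrow>\<^sub>M prior n" "g \<in> N \<rightarrow>\<^sub>M M"
  shows "(\<lambda>z. loss m (f z) (g z)) \<in> borel_measurable N"
  unfolding loss_def by measurable

text \<open>The tangent of \<open>exp (- t)\<close> at \<open>t = s\<close>, with the negative term moved to the other side. Integrated
  over the prior it replaces Jensen's inequality and needs no integrability.\<close>

lemma lik_tangent:
  assumes q: "prob_density q" and pos: "\<forall>i. 0 < p0 (X i \<omega>)" and s: "0 \<le> s"
  shows "ennreal (exp (- s) * (1 + s)) \<le> lik n q \<omega> + ennreal (exp (- s)) * loss n q \<omega>"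
proof (cases "loss n q \<omega> = \<infinity>")
  case False
  define t where "t i = enn2real (e2ennreal (log_ratio (p0 (X i \<omega>)) (q (X i \<omega>))))" for i
  have t: "e2ennreal (log_ratio (p0 (X i \<omega>)) (q (X i \<omega>))) = ennreal (t i)" "0 \<le> t i" if "i < n" for i
    using False that by (auto simp: loss_def t_def ennreal_enn2real_if)
  have loss: "loss n q \<omega> = ennreal (\<Sum>i<n. t i)"
  proof -
    have "loss n q \<omega> = (\<Sum>i<n. ennreal (t i))" unfolding loss_def using t(1) by simp
    also have "\<dots> = ennreal (\<Sum>i<n. t i)" by (rule sum_ennreal) (simp add: t(2))
    finally show ?thesis .
  qed
  have "exp (- (\<Sum>i<n. t i)) = (\<Prod>i<n. exp (- t i))"
    by (simp add: exp_sum sum_negf[symmetric])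
  also have "\<dots> \<le> (\<Prod>i<n. q (X i \<omega>) / p0 (X i \<omega>))"
    using t pos prob_densityD(2)[OF q] by (intro prod_mono) (auto intro!: exp_minus_le_ratio)
  finally have le: "exp (- (\<Sum>i<n. t i)) \<le> (\<Prod>i<n. q (X i \<omega>) / p0 (X i \<omega>))" .
  have "exp (- s) * (1 + (s - (\<Sum>i<n. t i))) \<le> exp (- s) * exp (s - (\<Sum>i<n. t i))"
    by (intro mult_left_mono exp_ge_add_one_self) simp
  also have "\<dots> = exp (- (\<Sum>i<n. t i))" by (subst exp_add[symmetric]) simp
  also note le
  finally have "exp (- s) * (1 + s) \<le> (\<Prod>i<n. q (X i \<omega>) / p0 (X i \<omega>)) + exp (- s) * (\<Sum>i<n. t i)"
    by (simp add: algebra_simps)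
  then have "ennreal (exp (- s) * (1 + s))
      \<le> ennreal ((\<Prod>i<n. q (X i \<omega>) / p0 (X i \<omega>)) + exp (- s) * (\<Sum>i<n. t i))"
    by (rule ennreal_leI)
  also have "\<dots> = lik n q \<omega> + ennreal (exp (- s)) * loss n q \<omega>"
    unfolding lik_def loss
    using t prob_densityD(2)[OF q] prob_densityD(2)[OF p0]
    by (subst ennreal_plus) (auto intro!: prod_nonneg mult_nonneg_nonneg sum_nonneg simp: ennreal_mult')
  finally show ?thesis .
qed (simp add: ennreal_mult_top)

lemma nn_integral_loss:
  assumes q: "prob_density q" and KL: "KL p0 q < ereal (\<delta>\<^sup>2 / 2)" and "0 < \<delta>"
  shows "(\<integral>\<^sup>+\<omega>. loss n q \<omega> \<partial>M) \<le> ennreal (real n * (\<delta> + \<delta>\<^sup>2 / 2))"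
proof -
  note [measurable] = prob_densityD(1)[OF q]
  have "(\<integral>\<^sup>+\<omega>. loss n q \<omega> \<partial>M)
      = (\<Sum>i<n. \<integral>\<^sup>+\<omega>. e2ennreal (log_ratio (p0 (X i \<omega>)) (q (X i \<omega>))) \<partial>M)"
    unfolding loss_def by (rule nn_integral_sum) simp
  also have "\<dots> \<le> (\<Sum>i<n. ennreal (\<delta> + \<delta>\<^sup>2 / 2))"
  proof (rule sum_mono)
    fix i
    have "(\<integral>\<^sup>+\<omega>. e2ennreal (log_ratio (p0 (X i \<omega>)) (q (X i \<omega>))) \<partial>M)
        = (\<integral>\<^sup>+x. e2ennreal (log_ratio (p0 x) (q x)) \<partial>P0)"
      unfolding distr_X[of i, symmetric] by (simp add: nn_integral_distr)
    also have "\<dots> \<le> ennreal (\<delta> + \<delta>\<^sup>2 / 2)" by (rule KL_positive_part[OF p0 q assms(3) KL])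
    finally show "(\<integral>\<^sup>+\<omega>. e2ennreal (log_ratio (p0 (X i \<omega>)) (q (X i \<omega>))) \<partial>M) \<le> ennreal (\<delta> + \<delta>\<^sup>2 / 2)" .
  qed
  also have "\<dots> = ennreal (real n * (\<delta> + \<delta>\<^sup>2 / 2))"
    using assms(3) by (simp add: ennreal_mult' ennreal_of_nat_eq_real_of_nat)
  finally show ?thesis .
qed

text \<open>Integrating the tangent inequality over \<open>K\<close> shows that the evidence is at
  least \<open>exp (- s) * k\<close> as soon as the integrated loss \<open>V\<close> is at most
  \<open>s * k\<close>. Since \<open>V\<close> has mean at most
  \<open>n * (\<delta> + \<delta>\<^sup>2 / 2) * k\<close>, Markov's inequality bounds the
  exceptional probability, and the prior mass \<open>k\<close> of the ball cancels.\<close>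

lemma evidence_small_prob:
  assumes K: "K \<in> sets (prior n)" "\<And>q. q \<in> K \<Longrightarrow> KL p0 q < ereal (\<delta>\<^sup>2 / 2)"
    and \<delta>: "0 < \<delta>" and s: "0 < s" and k: "0 < measure (prior n) K"
  shows "prob {\<omega> \<in> space M. (\<integral>\<^sup>+q. lik n q \<omega> \<partial>prior n) < ennreal (exp (- s) * measure (prior n) K)}
    \<le> real n * (\<delta> + \<delta>\<^sup>2 / 2) / s"
proof -
  note [measurable] = K(1)
  have KF: "K \<subseteq> F" using sets.sets_into_space[OF K(1)] by (simp add: space_prior)
  define k where "k = measure (prior n) K"
  have k0: "0 < k" and emK: "emeasure (prior n) K = ennreal k"
    using k by (simp_all add: k_def prior.emeasure_eq_measure)
  define V where "V \<omega> = (\<integral>\<^sup>+q. loss n q \<omega> * indicator K q \<partial>prior n)" for \<omega>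
  have [measurable]: "V \<in> borel_measurable M" unfolding V_def by measurable
  interpret pair_sigma_finite M "prior n" ..
  have "(\<integral>\<^sup>+\<omega>. V \<omega> \<partial>M) = (\<integral>\<^sup>+q. \<integral>\<^sup>+\<omega>. loss n q \<omega> * indicator K q \<partial>M \<partial>prior n)"
    unfolding V_def by (rule Fubini'[symmetric]) measurable
  also have "\<dots> \<le> (\<integral>\<^sup>+q. ennreal (real n * (\<delta> + \<delta>\<^sup>2 / 2)) * indicator K q \<partial>prior n)"
    using nn_integral_loss[OF prob_density_model K(2) \<delta>] KF
    by (intro nn_integral_mono) (auto simp: indicator_def)
  also have "\<dots> = ennreal (real n * (\<delta> + \<delta>\<^sup>2 / 2) * k)"
    using \<delta> k0 by (simp add: nn_integral_cmult_indicator emK ennreal_mult[symmetric])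
  finally have V_le: "(\<integral>\<^sup>+\<omega>. V \<omega> \<partial>M) \<le> ennreal (real n * (\<delta> + \<delta>\<^sup>2 / 2) * k)" .
  have large: "ennreal (exp (- s) * k) \<le> (\<integral>\<^sup>+q. lik n q \<omega> \<partial>prior n)"
    if \<omega>: "\<omega> \<in> space M" "\<forall>i. 0 < p0 (X i \<omega>)" "V \<omega> \<le> ennreal (s * k)" for \<omega>
  proof -
    note [measurable] = \<omega>(1)
    have "ennreal (exp (- s) * (1 + s)) * ennreal k
        = (\<integral>\<^sup>+q. ennreal (exp (- s) * (1 + s)) * indicator K q \<partial>prior n)"
      by (simp add: nn_integral_cmult_indicator emK)
    \<comment> \<open>The restriction to \<open>K\<close> is kept for the loss and dropped for the
      likelihood, which is nonnegative.\<close>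
    also have "\<dots> \<le> (\<integral>\<^sup>+q. lik n q \<omega> + ennreal (exp (- s)) * (loss n q \<omega> * indicator K q) \<partial>prior n)"
      using lik_tangent[OF prob_density_model \<omega>(2) less_imp_le[OF s]] KF
      by (intro nn_integral_mono) (auto simp: indicator_def)
    also have "\<dots> = (\<integral>\<^sup>+q. lik n q \<omega> \<partial>prior n) + ennreal (exp (- s)) * V \<omega>"
      unfolding V_def by (simp add: nn_integral_add nn_integral_cmult)
    also have "\<dots> \<le> (\<integral>\<^sup>+q. lik n q \<omega> \<partial>prior n) + ennreal (exp (- s)) * ennreal (s * k)"
      by (intro add_mono mult_left_mono \<omega>) auto
    finally have "ennreal (exp (- s) * (1 + s)) * ennreal k
        \<le> (\<integral>\<^sup>+q. lik n q \<omega> \<partial>prior n) + ennreal (exp (- s)) * ennreal (s * k)" .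
    moreover have "ennreal (exp (- s) * (1 + s)) * ennreal k
        = ennreal (exp (- s)) * ennreal (s * k) + ennreal (exp (- s) * k)"
      using s k0
      by (simp add: ennreal_mult[symmetric] ennreal_plus[symmetric] algebra_simps del: ennreal_plus)
    ultimately have "ennreal (exp (- s)) * ennreal (s * k) + ennreal (exp (- s) * k)
        \<le> ennreal (exp (- s)) * ennreal (s * k) + (\<integral>\<^sup>+q. lik n q \<omega> \<partial>prior n)"
      by (simp only: add.commute)
    moreover have "ennreal (exp (- s)) * ennreal (s * k) \<noteq> top"
      by (simp add: ennreal_mult_eq_top_iff)
    ultimately show ?thesis by (simp only: ennreal_add_left_cancel_le infinity_ennreal_def) blast
  qed
  have "emeasure M {\<omega> \<in> space M. (\<integral>\<^sup>+q. lik n q \<omega> \<partial>prior n) < ennreal (exp (- s) * k)}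
      \<le> emeasure M {\<omega> \<in> space M. 1 \<le> ennreal (1 / (s * k)) * V \<omega>}"
  proof (rule emeasure_mono_AE)
    show "AE \<omega> in M. \<omega> \<in> {\<omega> \<in> space M. (\<integral>\<^sup>+q. lik n q \<omega> \<partial>prior n) < ennreal (exp (- s) * k)}
        \<longrightarrow> \<omega> \<in> {\<omega> \<in> space M. 1 \<le> ennreal (1 / (s * k)) * V \<omega>}"
      using AE_p0_pos AE_space
    proof eventually_elim
      case (elim \<omega>)
      have "1 \<le> ennreal (1 / (s * k)) * V \<omega>" if "\<not> V \<omega> \<le> ennreal (s * k)"
      proof -
        have "1 = ennreal (1 / (s * k)) * ennreal (s * k)"
          using s k0 by (simp add: ennreal_mult[symmetric])
        also have "\<dots> \<le> ennreal (1 / (s * k)) * V \<omega>"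
          using that by (intro mult_left_mono) auto
        finally show ?thesis .
      qed
      then show ?case using large[of \<omega>] elim by (auto simp: not_less[symmetric])
    qed
  qed simp
  also have "\<dots> \<le> ennreal (1 / (s * k)) * (\<integral>\<^sup>+\<omega>. V \<omega> * indicator (space M) \<omega> \<partial>M)"
    by (rule nn_integral_Markov_inequality) auto
  also have "(\<integral>\<^sup>+\<omega>. V \<omega> * indicator (space M) \<omega> \<partial>M) = (\<integral>\<^sup>+\<omega>. V \<omega> \<partial>M)"
    by (intro nn_integral_cong) simp
  also have "ennreal (1 / (s * k)) * \<dots> \<le> ennreal (1 / (s * k)) * ennreal (real n * (\<delta> + \<delta>\<^sup>2 / 2) * k)"
    by (intro mult_left_mono V_le) simp
  also have "\<dots> = ennreal (real n * (\<delta> + \<delta>\<^sup>2 / 2) / s)"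
    using s k0 \<delta> by (simp add: ennreal_mult[symmetric])
  finally show ?thesis
    unfolding k_def[symmetric] using s \<delta> by (simp add: emeasure_eq_measure)
qed

text \<open>Half of the exponent, \<open>s = \<beta> / 2 * n\<close>, is the budget for the loss.
  The other half absorbs the prior mass of the ball, which stays above a constant.\<close>

lemma evidence_lower_bound:
  assumes KL: "\<And>\<epsilon>::real. 0 < \<epsilon> \<Longrightarrow> 0 < liminf (\<lambda>n. emeasure (prior n) {q \<in> F. KL p0 q < ereal \<epsilon>})"
    and \<beta>: "0 < \<beta>"
  shows "(\<lambda>n. prob {\<omega> \<in> space M. (\<integral>\<^sup>+q. lik n q \<omega> \<partial>prior n) < ennreal (exp (- \<beta> * real n))}) \<longlonglongrightarrow> 0"
    (is "?p \<longlonglongrightarrow> 0")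
proof (rule order_tendstoI)
  show "\<forall>\<^sub>F n in sequentially. a < ?p n" if "a < 0" for a
    using that by (auto intro!: always_eventually order_less_le_trans[OF _ measure_nonneg])
next
  fix \<eta> :: real assume \<eta>: "0 < \<eta>"
  \<comment> \<open>Since \<open>\<delta> \<le> 1\<close>, the failure probability is at most
    \<open>3 * \<delta> / \<beta>\<close>, hence at most \<open>3 / 4 * \<eta>\<close>, for every
    large \<open>n\<close>.\<close>
  define \<delta> where "\<delta> = min 1 (\<eta> * \<beta> / 4)"
  have \<delta>: "0 < \<delta>" "\<delta> \<le> 1" "\<delta> \<le> \<eta> * \<beta> / 4" using \<eta> \<beta> by (auto simp: \<delta>_def)
  define K where "K = {q \<in> F. KL p0 q < ereal (\<delta>\<^sup>2 / 2)}"
  have "0 < liminf (\<lambda>n. emeasure (prior n) K)" unfolding K_def using \<delta> by (intro KL) simp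
  then obtain c' where c': "0 < c'" "c' < liminf (\<lambda>n. emeasure (prior n) K)"
    using dense by blast
  then have "c' < top" using order_less_le_trans[OF c'(2) top_greatest] by simp
  then obtain c where c: "c' = ennreal c" "0 < c" using c'(1) by (cases c') auto
  have ev1: "\<forall>\<^sub>F n in sequentially. ennreal c < emeasure (prior n) K"
    using less_LiminfD[OF c'(2)] by (simp add: c)
  have "(\<lambda>n. exp (- \<beta> / 2 * real n)) \<longlonglongrightarrow> 0"
    using \<beta> by real_asymp
  then have ev2: "\<forall>\<^sub>F n in sequentially. exp (- \<beta> / 2 * real n) < c"
    using c(2) by (rule order_tendstoD)
  show "\<forall>\<^sub>F n in sequentially. ?p n < \<eta>"
    using ev1 ev2 eventually_gt_at_top[of 0]
  proof eventually_elim
    case (elim n)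
    \<comment> \<open>A set that is not measurable would have \<open>emeasure\<close> 0, so the
      Kullback--Leibler condition itself provides the measurability of the ball for large
      \<open>n\<close>.\<close>
    have meas: "K \<in> sets (prior n)"
      by (rule ccontr) (use elim(1) in \<open>simp add: emeasure_notin_sets\<close>)
    have k: "c < measure (prior n) K"
      using elim(1) c(2) by (simp add: prior.emeasure_eq_measure ennreal_less_iff)
    have "exp (- \<beta> * real n) = exp (- (\<beta> / 2 * real n)) * exp (- \<beta> / 2 * real n)"
      by (subst exp_add[symmetric]) simp
    also have "\<dots> \<le> exp (- (\<beta> / 2 * real n)) * measure (prior n) K"
      using k elim(2) by (intro mult_left_mono) auto
    finally have "ennreal (exp (- \<beta> * real n)) \<le> ennreal (exp (- (\<beta> / 2 * real n)) * measure (prior n) K)"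
      by (rule ennreal_leI)
    note le = order_less_le_trans[OF _ this]
    have "?p n \<le> prob {\<omega> \<in> space M. (\<integral>\<^sup>+q. lik n q \<omega> \<partial>prior n)
        < ennreal (exp (- (\<beta> / 2 * real n)) * measure (prior n) K)}"
      by (rule finite_measure_mono, rule Collect_mono, intro impI conjI, erule conjunct1,
          erule le[OF conjunct2], measurable)
    also have "\<dots> \<le> real n * (\<delta> + \<delta>\<^sup>2 / 2) / (\<beta> / 2 * real n)"
      using k c(2) \<beta> elim(3) by (intro evidence_small_prob[OF meas _ \<delta>(1)]) (auto simp: K_def)
    also have "\<dots> = (\<delta> + \<delta>\<^sup>2 / 2) * 2 / \<beta>" using elim(3) \<beta> by (simp add: field_simps)
    also have "\<dots> \<le> (\<delta> + \<delta> / 2) * 2 / \<beta>"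
      using \<delta> \<beta> by (intro divide_right_mono mult_right_mono add_left_mono)
        (auto simp: power2_eq_square mult_left_le)
    also have "\<dots> < \<eta>"
      using \<delta>(1,3) \<beta> \<eta> by (simp add: field_simps)
    finally show ?case .
  qed
qed

section \<open>Measurability in the density\<close>

lemma measure_measurable:
  assumes [measurable]: "B \<in> sets borel"
  shows "(\<lambda>q. measure (density_measure q) B) \<in> borel_measurable (prior n)"
proof -
  have "measure (density_measure q) B = enn2real (\<integral>\<^sup>+x. ennreal (q x) * indicator B x \<partial>lborel)"
    if "q \<in> space (prior n)" for q
    using prob_densityD(1)[OF prob_density_model, of q] that
    by (simp add: space_prior measure_def density_measure_def emeasure_density)
  moreover have "(\<lambda>q. enn2real (\<integral>\<^sup>+x. ennreal (q x) * indicator B x \<partial>lborel)) \<in> borel_measurable (prior n)"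
    by measurable
  ultimately show ?thesis by (simp cong: measurable_cong)
qed

lemma moment_measurable:
  "(\<lambda>q. moment p (density_measure q)) \<in> borel_measurable (prior n)"
proof -
  have "moment p (density_measure q) = (\<integral>\<^sup>+x. ennreal (q x) * ennreal (\<bar>x\<bar> powr p) \<partial>lborel)"
    if "q \<in> space (prior n)" for q
    unfolding moment_def using prob_density_model[of q] that
    by (intro nn_integral_density_measure) (auto simp: space_prior)
  moreover have "(\<lambda>q. \<integral>\<^sup>+x. ennreal (q x) * ennreal (\<bar>x\<bar> powr p) \<partial>lborel) \<in> borel_measurable (prior n)"
    by measurable
  ultimately show ?thesis by (simp cong: measurable_cong)
qed

section \<open>Schwartz's argument with a frequency test\<close>

lemma expected_numerator:
  assumes [measurable]: "A \<in> sets (prior n)" "\<Omega> \<in> sets M"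
    and le: "\<And>q. q \<in> A \<Longrightarrow> (\<integral>\<^sup>+\<omega>. lik n q \<omega> * indicator \<Omega> \<omega> \<partial>M) \<le> ennreal t"
  shows "(\<integral>\<^sup>+\<omega>. (\<integral>\<^sup>+q\<in>A. lik n q \<omega> \<partial>prior n) * indicator \<Omega> \<omega> \<partial>M) \<le> ennreal t"
proof -
  interpret pair_sigma_finite M "prior n" ..
  have "(\<integral>\<^sup>+\<omega>. (\<integral>\<^sup>+q\<in>A. lik n q \<omega> \<partial>prior n) * indicator \<Omega> \<omega> \<partial>M)
      = (\<integral>\<^sup>+\<omega>. \<integral>\<^sup>+q. lik n q \<omega> * indicator A q * indicator \<Omega> \<omega> \<partial>prior n \<partial>M)"
    by (intro nn_integral_cong nn_integral_multc[symmetric]) measurable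
  also have "\<dots> = (\<integral>\<^sup>+q. \<integral>\<^sup>+\<omega>. lik n q \<omega> * indicator A q * indicator \<Omega> \<omega> \<partial>M \<partial>prior n)"
    by (rule Fubini'[symmetric]) measurable
  also have "\<dots> \<le> (\<integral>\<^sup>+q. ennreal t \<partial>prior n)"
    using le by (intro nn_integral_mono) (auto simp: indicator_def)
  also have "\<dots> = ennreal t" by (simp add: prior.emeasure_space_1)
  finally show ?thesis .
qed

text \<open>A posterior mass above \<open>\<delta>\<close> has three possible causes: the evidence
  is below \<open>d\<close>, the data leave the acceptance region \<open>\<Omega>\<close>, or the
  numerator reaches \<open>\<delta> * d\<close> on \<open>\<Omega>\<close>. Markov's inequality
  handles the last.\<close>

lemma posterior_tail_bound:
  assumes [measurable]: "A \<in> sets (prior n)" "\<Omega> \<in> sets M"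
    and le: "\<And>q. q \<in> A \<Longrightarrow> (\<integral>\<^sup>+\<omega>. lik n q \<omega> * indicator \<Omega> \<omega> \<partial>M) \<le> ennreal t"
    and t: "0 \<le> t" and d: "0 < d" and \<delta>: "0 < \<delta>"
  shows "prob {\<omega> \<in> space M. \<delta> < posterior p0 (prior n) n (\<lambda>i. X i \<omega>) A}
    \<le> prob {\<omega> \<in> space M. (\<integral>\<^sup>+q. lik n q \<omega> \<partial>prior n) < ennreal d} + prob (space M - \<Omega>) + t / (\<delta> * d)"
proof -
  let ?N = "\<lambda>\<omega>. \<integral>\<^sup>+q\<in>A. lik n q \<omega> \<partial>prior n" and ?D = "\<lambda>\<omega>. \<integral>\<^sup>+q. lik n q \<omega> \<partial>prior n"
  let ?S1 = "{\<omega> \<in> space M. ?D \<omega> < ennreal d}"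
  let ?S3 = "{\<omega> \<in> \<Omega>. 1 \<le> ennreal (1 / (\<delta> * d)) * ?N \<omega>}"
  have \<Omega>: "\<Omega> \<subseteq> space M" using sets.sets_into_space[of \<Omega> M] by simp
  have S3: "?S3 = {\<omega> \<in> space M. \<omega> \<in> \<Omega> \<and> 1 \<le> ennreal (1 / (\<delta> * d)) * ?N \<omega>}" using \<Omega> by auto
  have [measurable]: "?S3 \<in> sets M" unfolding S3 by measurable
  have bound: "posterior p0 (prior n) n (\<lambda>i. X i \<omega>) A \<le> \<delta>"
    if D: "ennreal d \<le> ?D \<omega>" and N: "\<not> 1 \<le> ennreal (1 / (\<delta> * d)) * ?N \<omega>" for \<omega>
  proof -
    have "?N \<omega> \<le> ennreal (\<delta> * d)"
    proof (rule ccontr)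
      assume "\<not> ?N \<omega> \<le> ennreal (\<delta> * d)"
      then have "ennreal (1 / (\<delta> * d)) * ennreal (\<delta> * d) \<le> ennreal (1 / (\<delta> * d)) * ?N \<omega>"
        by (intro mult_left_mono) auto
      moreover have "ennreal (1 / (\<delta> * d)) * ennreal (\<delta> * d) = 1"
        using \<delta> d by (simp add: ennreal_mult[symmetric])
      ultimately show False using N by simp
    qed
    also have "\<dots> \<le> ennreal \<delta> * ?D \<omega>"
      using D \<delta> by (simp add: ennreal_mult' mult_left_mono)
    finally have N_le: "?N \<omega> \<le> ?D \<omega> * ennreal \<delta>" by (simp only: mult.commute)
    have "0 < ?D \<omega>" using d by (intro order_less_le_trans[OF _ D]) simp
    then have "?N \<omega> / ?D \<omega> \<le> ennreal \<delta>" using N_le by (rule divide_le_posI_ennreal)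
    then show ?thesis
      unfolding posterior_eq using \<delta> enn2real_mono[of _ "ennreal \<delta>"] by fastforce
  qed
  have "{\<omega> \<in> space M. \<delta> < posterior p0 (prior n) n (\<lambda>i. X i \<omega>) A} \<subseteq> ?S1 \<union> (space M - \<Omega>) \<union> ?S3"
  proof (rule subsetI)
    fix \<omega> assume \<omega>: "\<omega> \<in> {\<omega> \<in> space M. \<delta> < posterior p0 (prior n) n (\<lambda>i. X i \<omega>) A}"
    then have "\<not> ennreal d \<le> ?D \<omega> \<or> 1 \<le> ennreal (1 / (\<delta> * d)) * ?N \<omega>"
      using bound[of \<omega>] by fastforce
    then show "\<omega> \<in> ?S1 \<union> (space M - \<Omega>) \<union> ?S3"
      using \<omega> by (simp only: mem_Collect_eq Un_iff Diff_iff not_le) blast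
  qed
  then have "prob {\<omega> \<in> space M. \<delta> < posterior p0 (prior n) n (\<lambda>i. X i \<omega>) A}
      \<le> prob (?S1 \<union> (space M - \<Omega>) \<union> ?S3)"
    by (intro finite_measure_mono) measurable
  also have "\<dots> \<le> prob ?S1 + prob (space M - \<Omega>) + prob ?S3"
    by (intro order_trans[OF measure_Un_le] add_mono measure_Un_le order_refl) measurable
  also have "prob ?S3 \<le> t / (\<delta> * d)"
  proof -
    have "emeasure M ?S3 \<le> ennreal (1 / (\<delta> * d)) * (\<integral>\<^sup>+\<omega>. ?N \<omega> * indicator \<Omega> \<omega> \<partial>M)"
      by (rule nn_integral_Markov_inequality) measurable
    also have "\<dots> \<le> ennreal (1 / (\<delta> * d)) * ennreal t"
      by (intro mult_left_mono expected_numerator le) auto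
    also have "\<dots> = ennreal (t / (\<delta> * d))" using t d \<delta> by (simp add: ennreal_mult[symmetric])
    finally show ?thesis using t d \<delta> by (simp add: emeasure_eq_measure)
  qed
  finally show ?thesis by simp
qed

text \<open>The test accepts while the empirical frequency of \<open>B\<close> is at most
  \<open>c\<close>, halfway between the true mass and the smallest alternative mass. Both error
  bounds have rate \<open>\<gamma>\<close>, the Chernoff exponent for a deviation
  \<open>\<epsilon> / 2\<close>. A deficit on \<open>B\<close> is an excess on its complement, so
  the one-sided form suffices.\<close>

lemma posterior_prob_excess_tendsto:
  assumes KL: "\<And>\<epsilon>::real. 0 < \<epsilon> \<Longrightarrow> 0 < liminf (\<lambda>n. emeasure (prior n) {q \<in> F. KL p0 q < ereal \<epsilon>})"
    and B [measurable]: "B \<in> sets borel" and \<epsilon>: "0 < \<epsilon>"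
  shows "tendsto_in_prob M (\<lambda>n \<omega>. posterior p0 (prior n) n (\<lambda>i. X i \<omega>)
      {q \<in> F. measure P0 B + \<epsilon> \<le> measure (density_measure q) B}) 0"
  unfolding tendsto_in_prob_def
proof (intro allI impI)
  fix \<delta> :: real assume \<delta>: "0 < \<delta>"
  define A where "A = {q \<in> F. measure P0 B + \<epsilon> \<le> measure (density_measure q) B}"
  define c where "c = measure P0 B + \<epsilon> / 2"
  define \<gamma> where "\<gamma> = (\<epsilon> / 2)\<^sup>2 / 2"
  have \<gamma>: "0 < \<gamma>" using \<epsilon> by (simp add: \<gamma>_def)
  have A: "A \<in> sets (prior n)" for n
  proof -
    note [measurable] = measure_measurable[OF B, of n]
    have "A = {q \<in> space (prior n). measure P0 B + \<epsilon> \<le> measure (density_measure q) B}"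
      by (simp add: A_def space_prior)
    then show ?thesis by simp
  qed
  define \<Omega> where "\<Omega> n = {\<omega> \<in> space M. (\<Sum>i<n. indicat_real B (X i \<omega>)) \<le> real n * c}" for n
  have [measurable]: "\<Omega> n \<in> sets M" for n unfolding \<Omega>_def by measurable
  have num: "(\<integral>\<^sup>+\<omega>. lik n q \<omega> * indicator (\<Omega> n) \<omega> \<partial>M) \<le> ennreal (exp (- \<gamma> * real n))" if "q \<in> A" for n q
  proof -
    have "(\<integral>\<^sup>+\<omega>. lik n q \<omega> * indicator (\<Omega> n) \<omega> \<partial>M)
      = (\<integral>\<^sup>+\<omega>. lik n q \<omega> * indicator {\<omega>. (\<Sum>i<n. indicat_real B (X i \<omega>)) \<le> real n * c} \<omega> \<partial>M)"
      by (intro nn_integral_cong) (auto simp: \<Omega>_def indicator_def)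
    also have "\<dots> \<le> ennreal (exp (- \<gamma> * real n))"
      unfolding \<gamma>_def using that \<epsilon>
      by (intro likelihood_lower_tail prob_density_model) (auto simp: A_def c_def)
    finally show ?thesis .
  qed
  have test: "prob (space M - \<Omega> n) \<le> exp (- \<gamma> * real n)" for n
  proof -
    have compl: "measure P0 (- B) = 1 - measure P0 B"
      using P0.prob_compl[of B] by (simp add: Compl_eq_Diff_UNIV)
    have "emeasure M (space M - \<Omega> n) = (\<integral>\<^sup>+\<omega>. indicator (space M - \<Omega> n) \<omega> \<partial>M)"
      by simp
    \<comment> \<open>The false rejection is again a lower tail, now for the complement of
      \<open>B\<close> and the density \<open>p0\<close>, whose likelihood ratio is almost surely
      1.\<close>
    also have "\<dots> \<le> (\<integral>\<^sup>+\<omega>. lik n p0 \<omega>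
        * indicator {\<omega>. (\<Sum>i<n. indicat_real (- B) (X i \<omega>)) \<le> real n * (1 - c)} \<omega> \<partial>M)"
      using AE_p0_pos
    proof (intro nn_integral_mono_AE, eventually_elim)
      case (elim \<omega>)
      have "lik n p0 \<omega> = 1"
        unfolding lik_def using elim by (simp add: less_imp_neq[symmetric])
      moreover have "(\<Sum>i<n. indicat_real (- B) (X i \<omega>)) = real n - (\<Sum>i<n. indicat_real B (X i \<omega>))"
        by (simp add: indicator_compl sum_subtractf)
      ultimately show ?case by (auto simp: \<Omega>_def indicator_def[of "_ - _"] algebra_simps)
    qed
    also have "\<dots> \<le> ennreal (exp (- \<gamma> * real n))"
      unfolding \<gamma>_def using \<epsilon>
      by (intro likelihood_lower_tail p0) (auto simp: c_def compl)
    finally show ?thesis by (simp add: emeasure_eq_measure)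
  qed
  \<comment> \<open>The evidence is bounded at half the rate, so that the numerator divided by it
    still decays like \<open>exp (- \<gamma> / 2 * n)\<close>.\<close>
  let ?p = "\<lambda>n. prob {\<omega> \<in> space M. (\<integral>\<^sup>+q. lik n q \<omega> \<partial>prior n) < ennreal (exp (- (\<gamma> / 2) * real n))}"
  show "(\<lambda>n. prob {\<omega> \<in> space M. \<delta> < dist (posterior p0 (prior n) n (\<lambda>i. X i \<omega>)
      {q \<in> F. measure P0 B + \<epsilon> \<le> measure (density_measure q) B}) 0}) \<longlonglongrightarrow> 0"
    unfolding A_def[symmetric]
  proof (rule tendsto_sandwich[of "\<lambda>_. 0" _ _ "\<lambda>n. ?p n + exp (- \<gamma> * real n) + exp (- (\<gamma> / 2) * real n) / \<delta>"])
    have "prob {\<omega> \<in> space M. \<delta> < posterior p0 (prior n) n (\<lambda>i. X i \<omega>) A}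
        \<le> ?p n + exp (- \<gamma> * real n) + exp (- (\<gamma> / 2) * real n) / \<delta>" for n
    proof -
      have "exp (- \<gamma> * real n) / (\<delta> * exp (- (\<gamma> / 2) * real n)) = exp (- (\<gamma> / 2) * real n) / \<delta>"
      proof -
        have "exp (- \<gamma> * real n) = exp (- (\<gamma> / 2) * real n) * exp (- (\<gamma> / 2) * real n)"
          by (subst exp_add[symmetric]) simp
        then show ?thesis by (simp only: mult_divide_mult_cancel_right exp_not_eq_zero not_False_eq_True)
      qed
      then show ?thesis
        using posterior_tail_bound[OF A _ num, of n "exp (- (\<gamma> / 2) * real n)" \<delta>] test[of n] \<delta> by simp
    qed
    then show "\<forall>\<^sub>F n in sequentially. prob {\<omega> \<in> space M. \<delta> < dist (posterior p0 (prior n) n (\<lambda>i. X i \<omega>) A) 0}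
        \<le> ?p n + exp (- \<gamma> * real n) + exp (- (\<gamma> / 2) * real n) / \<delta>"
      by (simp add: dist_real_def posterior_def)
    have "(\<lambda>n. exp (- \<gamma> * real n) + exp (- (\<gamma> / 2) * real n) / \<delta>) \<longlonglongrightarrow> 0"
      using \<gamma> \<delta> by real_asymp
    from tendsto_add[OF evidence_lower_bound[OF KL, of "\<gamma> / 2"] this]
    show "(\<lambda>n. ?p n + exp (- \<gamma> * real n) + exp (- (\<gamma> / 2) * real n) / \<delta>) \<longlonglongrightarrow> 0"
      using \<gamma> by (simp add: add.assoc)
  qed (auto intro!: always_eventually)
qed

section \<open>Calculus of vanishing posterior mass\<close>

text \<open>\<open>enn2real\<close> maps infinity to 0 and is monotone only below it, so finiteness
  of the quotient comes before monotonicity and subadditivity of the posterior. For a zero or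
  infinite denominator the conventions of \<open>ennreal\<close> division make the quotient
  0.\<close>

lemma posterior_finite:
  "(\<integral>\<^sup>+q\<in>A. lik n q \<omega> \<partial>prior n) / (\<integral>\<^sup>+q. lik n q \<omega> \<partial>prior n) < top"
proof -
  define N where "N = (\<integral>\<^sup>+q\<in>A. lik n q \<omega> \<partial>prior n)"
  define D where "D = (\<integral>\<^sup>+q. lik n q \<omega> \<partial>prior n)"
  have "N \<le> D" unfolding N_def D_def by (intro nn_integral_mono) (simp add: indicator_def)
  then have "N / D < top"
  proof (cases D)
    case (real d)
    then show ?thesis
      using \<open>N \<le> D\<close> by (cases "d = 0"; cases N) (auto simp: divide_ennreal less_top[symmetric] top_unique)
  qed simp
  then show ?thesis by (simp add: N_def D_def)
qed

lemma posterior_mono: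
  assumes "A \<subseteq> B"
  shows "posterior p0 (prior n) n (\<lambda>i. X i \<omega>) A \<le> posterior p0 (prior n) n (\<lambda>i. X i \<omega>) B"
  unfolding posterior_eq using assms
  by (intro enn2real_mono posterior_finite divide_right_mono_ennreal nn_integral_mono)
    (auto simp: indicator_def)

lemma posterior_Un_le:
  assumes [measurable]: "A \<in> sets (prior n)" "B \<in> sets (prior n)" and \<omega> [measurable]: "\<omega> \<in> space M"
  shows "posterior p0 (prior n) n (\<lambda>i. X i \<omega>) (A \<union> B)
    \<le> posterior p0 (prior n) n (\<lambda>i. X i \<omega>) A + posterior p0 (prior n) n (\<lambda>i. X i \<omega>) B"
proof -
  let ?N = "\<lambda>A. \<integral>\<^sup>+q\<in>A. lik n q \<omega> \<partial>prior n" and ?D = "\<integral>\<^sup>+q. lik n q \<omega> \<partial>prior n"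
  have "?N (A \<union> B) \<le> (\<integral>\<^sup>+q. lik n q \<omega> * indicator A q + lik n q \<omega> * indicator B q \<partial>prior n)"
    by (intro nn_integral_mono) (simp add: indicator_def)
  also have "\<dots> = ?N A + ?N B" by (rule nn_integral_add) measurable
  finally have "?N (A \<union> B) / ?D \<le> ?N A / ?D + ?N B / ?D"
    by (simp add: add_divide_distrib_ennreal[symmetric] divide_right_mono_ennreal)
  then have "enn2real (?N (A \<union> B) / ?D) \<le> enn2real (?N A / ?D + ?N B / ?D)"
    using posterior_finite by (intro enn2real_mono) simp_all
  then show ?thesis
    unfolding posterior_eq using posterior_finite by (simp add: enn2real_plus)
qed

lemma posterior_nonneg: "0 \<le> posterior p0 (prior n) n x A"
  by (simp add: posterior_def)

abbreviation vanishing :: "(real \<Rightarrow> real) set \<Rightarrow> bool" where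
  "vanishing A \<equiv> tendsto_in_prob M (\<lambda>n \<omega>. posterior p0 (prior n) n (\<lambda>i. X i \<omega>) A) 0"

lemma vanishing_iff:
  "vanishing A \<longleftrightarrow> (\<forall>\<delta>>0. (\<lambda>n. prob {\<omega> \<in> space M. \<delta> < posterior p0 (prior n) n (\<lambda>i. X i \<omega>) A}) \<longlonglongrightarrow> 0)"
  by (simp add: tendsto_in_prob_def dist_real_def posterior_nonneg)

text \<open>Monotonicity of probability needs the larger event to be measurable. This is what the
  measurability of the moment, distribution function and Wasserstein deviations is for.\<close>

lemma vanishing_mono:
  assumes "vanishing B" "A \<subseteq> B" and [measurable]: "\<And>n. B \<in> sets (prior n)"
  shows "vanishing A"
  unfolding vanishing_iff
proof (intro allI impI)
  fix \<delta> :: real assume "0 < \<delta>"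
  with assms(1) have B: "(\<lambda>n. prob {\<omega> \<in> space M. \<delta> < posterior p0 (prior n) n (\<lambda>i. X i \<omega>) B}) \<longlonglongrightarrow> 0"
    by (simp add: vanishing_iff)
  have "prob {\<omega> \<in> space M. \<delta> < posterior p0 (prior n) n (\<lambda>i. X i \<omega>) A}
      \<le> prob {\<omega> \<in> space M. \<delta> < posterior p0 (prior n) n (\<lambda>i. X i \<omega>) B}" for n
  proof (rule finite_measure_mono)
    show "{\<omega> \<in> space M. \<delta> < posterior p0 (prior n) n (\<lambda>i. X i \<omega>) A}
      \<subseteq> {\<omega> \<in> space M. \<delta> < posterior p0 (prior n) n (\<lambda>i. X i \<omega>) B}"
      using order_less_le_trans[OF _ posterior_mono[OF assms(2)]] by auto
  qed measurable
  then show "(\<lambda>n. prob {\<omega> \<in> space M. \<delta> < posterior p0 (prior n) n (\<lambda>i. X i \<omega>) A}) \<longlonglongrightarrow> 0"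
    by (intro tendsto_sandwich[OF _ _ tendsto_const B]) (auto intro!: always_eventually)
qed

lemma vanishing_Un:
  assumes "vanishing A" "vanishing B"
    and [measurable]: "\<And>n. A \<in> sets (prior n)" "\<And>n. B \<in> sets (prior n)"
  shows "vanishing (A \<union> B)"
  unfolding vanishing_iff
proof (intro allI impI)
  fix \<delta> :: real assume "0 < \<delta>"
  then have half: "0 < \<delta> / 2" by simp
  have lim: "(\<lambda>n. prob {\<omega> \<in> space M. \<delta> / 2 < posterior p0 (prior n) n (\<lambda>i. X i \<omega>) A}
      + prob {\<omega> \<in> space M. \<delta> / 2 < posterior p0 (prior n) n (\<lambda>i. X i \<omega>) B}) \<longlonglongrightarrow> 0"
    by (intro tendsto_add_zero assms(1,2)[unfolded vanishing_iff, rule_format, OF half])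
  have "prob {\<omega> \<in> space M. \<delta> < posterior p0 (prior n) n (\<lambda>i. X i \<omega>) (A \<union> B)}
      \<le> prob {\<omega> \<in> space M. \<delta> / 2 < posterior p0 (prior n) n (\<lambda>i. X i \<omega>) A}
      + prob {\<omega> \<in> space M. \<delta> / 2 < posterior p0 (prior n) n (\<lambda>i. X i \<omega>) B}" for n
  proof (rule order_trans[OF finite_measure_mono measure_Un_le])
    show "{\<omega> \<in> space M. \<delta> < posterior p0 (prior n) n (\<lambda>i. X i \<omega>) (A \<union> B)}
      \<subseteq> {\<omega> \<in> space M. \<delta> / 2 < posterior p0 (prior n) n (\<lambda>i. X i \<omega>) A}
        \<union> {\<omega> \<in> space M. \<delta> / 2 < posterior p0 (prior n) n (\<lambda>i. X i \<omega>) B}"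
    proof (rule subsetI)
      fix \<omega> assume \<omega>: "\<omega> \<in> {\<omega> \<in> space M. \<delta> < posterior p0 (prior n) n (\<lambda>i. X i \<omega>) (A \<union> B)}"
      then have "\<delta> < posterior p0 (prior n) n (\<lambda>i. X i \<omega>) A + posterior p0 (prior n) n (\<lambda>i. X i \<omega>) B"
        using posterior_Un_le[OF assms(3,4), of \<omega> n] by simp
      then have "\<delta> / 2 < posterior p0 (prior n) n (\<lambda>i. X i \<omega>) A
          \<or> \<delta> / 2 < posterior p0 (prior n) n (\<lambda>i. X i \<omega>) B" by linarith
      then show "\<omega> \<in> {\<omega> \<in> space M. \<delta> / 2 < posterior p0 (prior n) n (\<lambda>i. X i \<omega>) A}
        \<union> {\<omega> \<in> space M. \<delta> / 2 < posterior p0 (prior n) n (\<lambda>i. X i \<omega>) B}" using \<omega> by auto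
    qed
  qed measurable
  then show "(\<lambda>n. prob {\<omega> \<in> space M. \<delta> < posterior p0 (prior n) n (\<lambda>i. X i \<omega>) (A \<union> B)}) \<longlonglongrightarrow> 0"
    by (intro tendsto_sandwich[OF _ _ tendsto_const lim]) (auto intro!: always_eventually)
qed

lemma vanishing_UN:
  assumes "finite I" "\<And>i. i \<in> I \<Longrightarrow> vanishing (A i)" "\<And>i n. i \<in> I \<Longrightarrow> A i \<in> sets (prior n)"
  shows "vanishing (\<Union>i\<in>I. A i)"
  using assms
proof (induction I)
  case empty
  then show ?case by (simp add: tendsto_in_prob_def posterior_eq)
next
  case (insert i I)
  then show ?case by (simp only: UN_insert) (intro vanishing_Un sets.finite_UN; simp)
qed

section \<open>The equivalence\<close>

lemma moment_consistency_iff_wasserstein: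
  assumes p: "0 < p" and fin: "moment p P0 < \<infinity>"
    and KL: "\<And>\<epsilon>::real. 0 < \<epsilon> \<Longrightarrow> 0 < liminf (\<lambda>n. emeasure (prior n) {q \<in> F. KL p0 q < ereal \<epsilon>})"
  shows "(\<forall>\<epsilon>>0. vanishing {q \<in> F. \<bar>enn2ereal (moment p (density_measure q)) - enn2ereal (moment p P0)\<bar> > ereal \<epsilon>})
    \<longleftrightarrow> (\<forall>\<epsilon>>0. vanishing {q \<in> F. wasserstein p (density_measure q) P0 \<ge> ennreal \<epsilon>})"
    (is "(\<forall>\<epsilon>>0. vanishing (?A \<epsilon>)) \<longleftrightarrow> (\<forall>\<epsilon>>0. vanishing (?W \<epsilon>))")
proof (intro iffI allI impI)
  have A_sets: "?A \<epsilon> \<in> sets (prior n)" for \<epsilon> n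
  proof -
    note [measurable] = moment_measurable[of p n]
    have "{q \<in> space (prior n). ereal \<epsilon> < \<bar>enn2ereal (moment p (density_measure q)) - enn2ereal (moment p P0)\<bar>}
        \<in> sets (prior n)"
      by measurable
    then show ?thesis by (simp add: space_prior)
  qed
  fix \<epsilon> :: real assume A: "\<forall>\<epsilon>>0. vanishing (?A \<epsilon>)" and \<epsilon>: "0 < \<epsilon>"
  obtain \<delta> R where \<delta>: "0 < \<delta>" and R: "finite R"
    and nhd: "\<And>Q. real_distribution Q \<Longrightarrow> \<bar>enn2ereal (moment p Q) - enn2ereal (moment p P0)\<bar> \<le> ereal \<delta> \<Longrightarrow>
      (\<And>r. r \<in> R \<Longrightarrow> \<bar>cdf Q r - cdf P0 r\<bar> \<le> \<delta>) \<Longrightarrow> wasserstein p Q P0 < ennreal \<epsilon>"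
    using wasserstein_nhd[OF real_distribution_density_measure[OF p0] fin p \<epsilon>] by blast
  \<comment> \<open>With \<open>B = {..r}\<close> this is an upward deviation of the distribution
    function at \<open>r\<close>, with \<open>B = {r<..}\<close> a downward one.\<close>
  define E where "E B = {q \<in> F. measure P0 B + \<delta> \<le> measure (density_measure q) B}" for B
  have E_sets: "E B \<in> sets (prior n)" if "B \<in> sets borel" for B n
  proof -
    note [measurable] = measure_measurable[OF that, of n]
    have "{q \<in> space (prior n). measure P0 B + \<delta> \<le> measure (density_measure q) B} \<in> sets (prior n)"
      by measurable
    then show ?thesis by (simp add: space_prior E_def)
  qed
  have E_vanishing: "vanishing (E B)" if "B \<in> sets borel" for B
    unfolding E_def by (rule posterior_prob_excess_tendsto[OF KL that \<delta>])
  have "vanishing (?A \<delta> \<union> (\<Union>r\<in>R. E {..r} \<union> E {r<..}))"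
    using A \<delta> R by (intro vanishing_Un vanishing_UN E_vanishing E_sets A_sets sets.Un sets.finite_UN) auto
  then show "vanishing (?W \<epsilon>)"
  proof (rule vanishing_mono)
    show "?W \<epsilon> \<subseteq> ?A \<delta> \<union> (\<Union>r\<in>R. E {..r} \<union> E {r<..})"
    proof (rule subsetI, rule ccontr)
      fix q assume q: "q \<in> ?W \<epsilon>" and not: "q \<notin> ?A \<delta> \<union> (\<Union>r\<in>R. E {..r} \<union> E {r<..})"
      have "q \<in> F" using q by simp
      then interpret Q: real_distribution "density_measure q"
        by (intro real_distribution_density_measure prob_density_model)
      have "\<bar>cdf (density_measure q) r - cdf P0 r\<bar> \<le> \<delta>" if "r \<in> R" for r
      proof -
        have compl: "{r<..} = UNIV - {..r}" by auto
        have "q \<notin> E {..r}" "q \<notin> E {r<..}" using not that by auto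
        moreover have "measure P0 {r<..} = 1 - cdf P0 r"
          using P0.prob_compl[of "{..r}"] by (simp add: compl cdf_def)
        moreover have "measure (density_measure q) {r<..} = 1 - cdf (density_measure q) r"
          using Q.prob_compl[of "{..r}"] by (simp add: compl cdf_def)
        ultimately show ?thesis using \<open>q \<in> F\<close> by (simp add: E_def cdf_def abs_le_iff)
      qed
      moreover have "\<bar>enn2ereal (moment p (density_measure q)) - enn2ereal (moment p P0)\<bar> \<le> ereal \<delta>"
        using not \<open>q \<in> F\<close> by (simp add: not_less)
      ultimately have "wasserstein p (density_measure q) P0 < ennreal \<epsilon>"
        by (intro nhd Q.real_distribution_axioms)
      then show False using q by (simp add: not_le[symmetric])
    qed
    show "?A \<delta> \<union> (\<Union>r\<in>R. E {..r} \<union> E {r<..}) \<in> sets (prior n)" for n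
      using R by (intro E_sets A_sets sets.Un sets.finite_UN) auto
  qed
next
  fix \<epsilon> :: real assume W: "\<forall>\<epsilon>>0. vanishing (?W \<epsilon>)" and \<epsilon>: "0 < \<epsilon>"
  obtain \<delta> where \<delta>: "0 < \<delta>"
    and control: "\<And>Q. wasserstein p Q P0 < ennreal \<delta> \<Longrightarrow> \<bar>enn2ereal (moment p Q) - enn2ereal (moment p P0)\<bar> \<le> ereal \<epsilon>"
    using wasserstein_controls_moment[OF fin p \<epsilon>] by blast
  have "vanishing (?W \<delta>)" using W \<delta> by simp
  then show "vanishing (?A \<epsilon>)"
  proof (rule vanishing_mono)
    show "?A \<epsilon> \<subseteq> ?W \<delta>" using control by (force simp: not_less[symmetric])
    \<comment> \<open>In this direction the Wasserstein deviation is the covering set, so its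
      measurability is required here.\<close>
    have "{q \<in> space (prior n). ennreal \<delta> \<le> wasserstein p (density_measure q) P0} \<in> sets (prior n)" for n
      using real_distribution_density_measure[OF prob_density_model]
      by (intro wasserstein_ge_measurable fin p \<delta>)
        (simp_all add: space_prior moment_measurable cdf_def measure_measurable)
    then show "?W \<delta> \<in> sets (prior n)" for n by (simp add: space_prior)
  qed
qed

end

theorem theorem2p1:
  fixes M :: "'a measure" and X :: "nat \<Rightarrow> 'a \<Rightarrow> real"
    and p0 :: "real \<Rightarrow> real" and F :: "(real \<Rightarrow> real) set"
    and prior :: "nat \<Rightarrow> (real \<Rightarrow> real) measure" and p :: real
  assumes "prob_space M"
    and "prob_density p0"
    and "prob_space.indep_vars M (\<lambda>_. borel) X UNIV"
    and "\<And>i. distr M borel (X i) = density_measure p0"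
    and "density_model F"
    and "\<And>n. prior_on F (prior n)"
    and "1 \<le> p"
    and "moment p (density_measure p0) < \<infinity>"
    and "\<And>\<epsilon>::real. 0 < \<epsilon> \<Longrightarrow>
           0 < liminf (\<lambda>n. emeasure (prior n) {q \<in> F. KL p0 q < ereal \<epsilon>})"
  shows "(\<forall>\<epsilon>>0. tendsto_in_prob M
            (\<lambda>n \<omega>. posterior p0 (prior n) n (\<lambda>i. X i \<omega>)
               {q \<in> F. \<bar>enn2ereal (moment p (density_measure q))
                        - enn2ereal (moment p (density_measure p0))\<bar> > ereal \<epsilon>}) 0)
     \<longleftrightarrow> (\<forall>\<epsilon>>0. tendsto_in_prob M
            (\<lambda>n \<omega>. posterior p0 (prior n) n (\<lambda>i. X i \<omega>)
               {q \<in> F. wasserstein p (density_measure q) (density_measure p0) \<ge> ennreal \<epsilon>}) 0)"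
proof -
  interpret posterior_model M X p0 F prior
    using assms(1-6) by (intro posterior_model.intro posterior_model_axioms.intro)
  show ?thesis using assms(7-9) by (intro moment_consistency_iff_wasserstein) simp_all
qed

end
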